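(* Let $P\subset\mathbb{R}^n$ be a convex polytope with $\dim P\ge1$, and $\ell$ a linear function nonconstant on every edge of $P$, such that for every vertex $v$ both $F^-(v)$ and $F^+(v)$ are faces of $P$ and the partition $O^-$ is a stratification. Then the faces of the monotone path polytope $\mathrm{CH}_\ell(P)$ are in bijection (via the correspondence described in the context) with sequences $(F_1,\dots,F_k)$ of positive-dimensional faces of $P$ such that the maximal vertex (with respect to $\ell$) of $F_{i-1}$ is the minimal vertex of $F_i$ for $i=2,\dots,k$, the minimal vertex of $F_1$ is the source of $P$, and the maximal vertex of $F_k$ is the sink of $P$. The dimension of the face of $\mathrm{CH}_\ell(P)$ corresponding to $(F_1,\dots,F_k)$ is $\dim F_1+\cdots+\dim F_k-k$.
   Context: Source/sink: the vertices of $P$ where $\ell$ is minimal/maximal. For a vertex $v$, $O^-(v)$ (resp. $O^+(v)$) is the union of relative interiors of faces $G$ of $P$ such that $\ell|_G$ attains its maximum (resp. minimum) at $v$; $F^\pm(v)$ is the closure of $O^\pm(v)$. $O^-=\{O^-(v)\}_v$ is a stratification if $O^-(u)\cap F^-(v)\ne\emptyset$ implies $O^-(u)\subset F^-(v)$. Monotone path polytope (Billera–Sturmfels): with $[a,b]=\ell(P)$, $a<b$, $\mathrm{CH}_\ell(P)=\{\frac{1}{b-a}\int_a^b\gamma(t)\,dt\}$ where $\gamma$ ranges over continuous maps $[a,b]\to P$ with $\ell(\gamma(t))=t$. Correspondence between faces and sequences: for a linear functional $\mu$, let $P^\mu_c$ be the face of the slice $P\cap\{\ell=c\}$ on which $\mu$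 is minimized; then $\bigcup_c P^\mu_c$ is the union of a sequence of faces $(F_1,\dots,F_k)$ of $P$ with the chaining properties above, and this sequence depends only on the face of $\mathrm{CH}_\ell(P)$ on which $\mu$ is minimized; the face is said to correspond to $(F_1,\dots,F_k)$. *)

theory Defs
  imports "HOL-Analysis.Analysis"
begin

definition min_vertex :: "('a::euclidean_space \<Rightarrow> real) \<Rightarrow> 'a set \<Rightarrow> 'a \<Rightarrow> bool" where
  "min_vertex l F v \<longleftrightarrow> v extreme_point_of F \<and> (\<forall>x\<in>F. l v \<le> l x)"

definition max_vertex :: "('a::euclidean_space \<Rightarrow> real) \<Rightarrow> 'a set \<Rightarrow> 'a \<Rightarrow> bool" where
  "max_vertex l F v \<longleftrightarrow> v extreme_point_of F \<and> (\<forall>x\<in>F. l x \<le> l v)"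

definition O_minus :: "'a::euclidean_space set \<Rightarrow> ('a \<Rightarrow> real) \<Rightarrow> 'a \<Rightarrow> 'a set" where
  "O_minus P l v = \<Union> {rel_interior G | G. G face_of P \<and> v \<in> G \<and> (\<forall>x\<in>G. l x \<le> l v)}"

definition O_plus :: "'a::euclidean_space set \<Rightarrow> ('a \<Rightarrow> real) \<Rightarrow> 'a \<Rightarrow> 'a set" where
  "O_plus P l v = \<Union> {rel_interior G | G. G face_of P \<and> v \<in> G \<and> (\<forall>x\<in>G. l v \<le> l x)}"

definition F_minus :: "'a::euclidean_space set \<Rightarrow> ('a \<Rightarrow> real) \<Rightarrow> 'a \<Rightarrow> 'a set" where
  "F_minus P l v = closure (O_minus P l v)"

definition F_plus :: "'a::euclidean_space set \<Rightarrow> ('a \<Rightarrow> real) \<Rightarrow> 'a \<Rightarrow> 'a set" where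
  "F_plus P l v = closure (O_plus P l v)"

definition O_minus_stratification :: "'a::euclidean_space set \<Rightarrow> ('a \<Rightarrow> real) \<Rightarrow> bool" where
  "O_minus_stratification P l \<longleftrightarrow>
     (\<forall>u v. u extreme_point_of P \<longrightarrow> v extreme_point_of P \<longrightarrow>
        O_minus P l u \<inter> F_minus P l v \<noteq> {} \<longrightarrow> O_minus P l u \<subseteq> F_minus P l v)"

definition monotone_path_polytope :: "'a::euclidean_space set \<Rightarrow> ('a \<Rightarrow> real) \<Rightarrow> 'a set" where
  "monotone_path_polytope P l =
     (let a = Inf (l ` P); b = Sup (l ` P) in
      {(1 / (b - a)) *\<^sub>R integral {a..b} \<gamma> | \<gamma>.
         continuous_on {a..b} \<gamma> \<and> \<gamma> ` {a..b} \<subseteq> P \<and> (\<forall>t\<in>{a..b}. l (\<gamma> t) = t)})"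

definition min_face :: "('a::euclidean_space \<Rightarrow> real) \<Rightarrow> 'a set \<Rightarrow> 'a set" where
  "min_face \<mu> S = {x \<in> S. \<forall>y\<in>S. \<mu> x \<le> \<mu> y}"

text \<open>A sequence \<open>(F\<^sub>1, \<dots>, F\<^sub>k)\<close>, with \<open>k \<ge> 1\<close>, is a list. Extremal vertices enter relationally;
  they are unique when \<open>l\<close> is nonconstant on every edge of \<open>P\<close>.\<close>

definition face_chain :: "'a::euclidean_space set \<Rightarrow> ('a \<Rightarrow> real) \<Rightarrow> 'a set list \<Rightarrow> bool" where
  "face_chain P l Fs \<longleftrightarrow>
     Fs \<noteq> [] \<and>
     (\<forall>F\<in>set Fs. F face_of P \<and> aff_dim F \<ge> 1) \<and>
     (\<forall>i. Suc i < length Fs \<longrightarrow> (\<exists>v. max_vertex l (Fs ! i) v \<and> min_vertex l (Fs ! Suc i) v)) \<and>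
     (\<exists>v. min_vertex l P v \<and> min_vertex l (hd Fs) v) \<and>
     (\<exists>v. max_vertex l P v \<and> max_vertex l (last Fs) v)"

definition induces_chain ::
    "'a::euclidean_space set \<Rightarrow> ('a \<Rightarrow> real) \<Rightarrow> ('a \<Rightarrow> real) \<Rightarrow> 'a set list \<Rightarrow> bool" where
  "induces_chain P l \<mu> Fs \<longleftrightarrow>
     face_chain P l Fs \<and> (\<Union>c. min_face \<mu> (P \<inter> {x. l x = c})) = \<Union> (set Fs)"

text \<open>Meaningful only when the induced chain is unique and depends only on the face \<open>\<Phi>\<close>, not on
  the chosen functional \<open>\<mu>\<close> minimized on \<open>\<Phi>\<close>.\<close>

definition corresponding_chain ::
    "'a::euclidean_space set \<Rightarrow> ('a \<Rightarrow> real) \<Rightarrow> 'a set \<Rightarrow> 'a set list" where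
  "corresponding_chain P l \<Phi> =
     (THE Fs. \<exists>\<mu>. linear \<mu> \<and> min_face \<mu> (monotone_path_polytope P l) = \<Phi> \<and> induces_chain P l \<mu> Fs)"

end

(*
The minimizers of a functional mu on the monotone path polytope are the averages of the sections that
stay in the union of the faces min_face (mu - c l) P, for varying slopes c; increasing c from the
source to the sink (parametric simplex method) turns these faces into a chain.

Conversely, every chain arises in this way. By the stratification hypothesis, a face F with minimal
vertex v has v in F^-(u) for all its vertices u, hence F^-(v) <= F^-(u), and this makes the directions
of F and of F^-(v) linearly independent. The functional is then built face by face along the chain: on
F^-(v) keep the functional of the previous step, and in the independent directions of F^+(v) prescribe a
large multiple of l plus a functional exposing the next face.

The same independence gives the dimension: the directions of the face of the monotone path polytope
are the direct sum of the spaces of directions of the F_i at constant l, of dimension dim F_i - 1.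
*)

theory Submission
  imports Defs
begin

text \<open>The hypotheses control only F^-(v) and F^+(v), whereas optimality of a functional at a
  vertex involves every face through it. The obstacle disappears because a vertex is optimal once it
  is optimal along the edges at it, and each such edge, being monotone for l, lies in F^-(v) or in
  F^+(v). Hence a functional may be prescribed on these two faces separately, and independence keeps
  the prescriptions free of conflict. Extending the functional past v to the top vertex w of the
  next face must also keep the earlier faces exposed, now inside the larger face F^-(w). The large
  multiple of l is the penalty for this: the functional that is 0 on the directions of F^-(v) and l
  on those of F^+(v) has F^-(v) as its exact set of minimizers on F^-(w). At the sink F^- is all of
  P, so the construction ends with a functional on P.\<close>

section \<open>Minimizing faces and vertices of polytopes\<close>

lemma linear_functional_inner:
  fixes f :: "'a::euclidean_space \<Rightarrow> real"
  assumes "linear f"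
  obtains a where "\<And>x. f x = a \<bullet> x"
proof
  show "f x = adjoint f 1 \<bullet> x" for x
    using adjoint_works[OF assms, of x 1] by (simp add: inner_commute)
qed

lemma linear_affine_comb:
  fixes f :: "'a::real_vector \<Rightarrow> real"
  assumes "linear f"
  shows "f ((1 - u) *\<^sub>R x + u *\<^sub>R y) = (1 - u) * f x + u * f y"
  using assms by (simp add: linear_add linear_cmul)

lemma min_face_subset: "min_face f S \<subseteq> S"
  by (auto simp: min_face_def)

lemma min_face_face_of:
  fixes f :: "'a::euclidean_space \<Rightarrow> real"
  assumes "convex S" "linear f"
  shows "min_face f S face_of S"
proof (cases "min_face f S = {}")
  case False
  then obtain m where m: "m \<in> S" "\<And>y. y \<in> S \<Longrightarrow> f m \<le> f y"
    by (auto simp: min_face_def)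
  obtain a where a: "\<And>x. f x = a \<bullet> x"
    using linear_functional_inner[OF assms(2)] by blast
  have "min_face f S = S \<inter> {x. a \<bullet> x = f m}"
    using m unfolding min_face_def a by force
  then show ?thesis
    using face_of_Int_supporting_hyperplane_ge[of S "f m" a] m a assms(1) by simp
qed auto

lemma min_face_nonempty:
  fixes f :: "'a::euclidean_space \<Rightarrow> real"
  assumes "compact S" "S \<noteq> {}" "linear f"
  shows "min_face f S \<noteq> {}"
proof -
  have "continuous_on S f"
    by (simp add: assms linear_continuous_on linear_conv_bounded_linear[symmetric])
  then show ?thesis
    using continuous_attains_inf[of S f] assms by (auto simp: min_face_def)
qed

lemma min_face_at:
  fixes f :: "'a::euclidean_space \<Rightarrow> real"
  assumes "z \<in> S" "\<And>x. x \<in> S \<Longrightarrow> f z \<le> f x"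
  shows "min_face f S = {x \<in> S. f x = f z}"
  using assms by (force simp: min_face_def)

lemma polytope_has_vertex:
  fixes Q :: "'a::euclidean_space set"
  assumes "polytope Q" "Q \<noteq> {}"
  obtains v where "v extreme_point_of Q"
  using assms extreme_point_exists_convex[of Q] polytope_imp_compact polytope_imp_convex by blast

lemma polytope_min_vertex:
  fixes Q :: "'a::euclidean_space set" and f :: "'a \<Rightarrow> real"
  assumes "polytope Q" "Q \<noteq> {}" "linear f"
  obtains v where "v extreme_point_of Q" "\<And>x. x \<in> Q \<Longrightarrow> f v \<le> f x"
proof -
  have F: "min_face f Q face_of Q"
    using assms min_face_face_of polytope_imp_convex by blast
  moreover have "min_face f Q \<noteq> {}"
    using assms min_face_nonempty polytope_imp_compact by blast
  ultimately obtain v where v: "v extreme_point_of (min_face f Q)"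
    using polytope_has_vertex face_of_polytope_polytope assms(1) by blast
  then have "v \<in> min_face f Q"
    by (simp add: extreme_point_of_def)
  then have "\<And>x. x \<in> Q \<Longrightarrow> f v \<le> f x"
    by (simp add: min_face_def)
  with v F show ?thesis
    using that extreme_point_of_face by blast
qed

lemma polytope_ge_of_vertices:
  fixes Q :: "'a::euclidean_space set" and f :: "'a \<Rightarrow> real"
  assumes "polytope Q" "linear f" "\<And>v. v extreme_point_of Q \<Longrightarrow> c \<le> f v" "x \<in> Q"
  shows "c \<le> f x"
proof -
  have "Q \<noteq> {}"
    using assms(4) by blast
  then obtain v where v: "v extreme_point_of Q" "\<And>y. y \<in> Q \<Longrightarrow> f v \<le> f y"
    using polytope_min_vertex[OF assms(1) _ assms(2)] by blast
  show ?thesis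
    using order_trans[OF assms(3)[OF v(1)] v(2)[OF assms(4)]] .
qed

lemma polytope_face_exposed:
  fixes Q :: "'a::euclidean_space set"
  assumes "polytope Q" "F face_of Q"
  obtains f :: "'a \<Rightarrow> real" and c where "linear f" "\<And>x. x \<in> Q \<Longrightarrow> c \<le> f x" "F = {x \<in> Q. f x = c}"
proof -
  have "F exposed_face_of Q"
    using assms exposed_face_of_polyhedron polytope_imp_polyhedron by blast
  then obtain a b where ab: "Q \<subseteq> {x. a \<bullet> x \<le> b}" "F = Q \<inter> {x. a \<bullet> x = b}"
    by (auto simp: exposed_face_of_def)
  have "linear (\<lambda>x. - (a \<bullet> x))"
    by (intro linear_compose_neg) (simp add: bounded_linear.linear bounded_linear_inner_right)
  with ab show ?thesis
    by (intro that[of "\<lambda>x. - (a \<bullet> x)" "-b"]) auto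
qed

section \<open>Directions of a set and their dimension\<close>

text \<open>The linear space parallel to the affine hull. All differences are taken, without a base
  point, so that inclusions of sets give inclusions of spaces at once.\<close>

definition directions :: "'a::euclidean_space set \<Rightarrow> 'a set" where
  "directions S = span {x - y | x y. x \<in> S \<and> y \<in> S}"

lemma subspace_directions: "subspace (directions S)"
  by (simp add: directions_def)

lemma diff_in_directions: "x \<in> S \<Longrightarrow> y \<in> S \<Longrightarrow> x - y \<in> directions S"
  unfolding directions_def by (intro span_base) blast

lemma directions_mono: "S \<subseteq> T \<Longrightarrow> directions S \<subseteq> directions T"
  unfolding directions_def by (intro span_mono) blast

lemma directions_eq:
  assumes "v \<in> S"
  shows "directions S = span ((\<lambda>x. x - v) ` S)"
proof
  have "x - y \<in> span ((\<lambda>x. x - v) ` S)" if "x \<in> S" "y \<in> S" for x y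
    using span_diff[of "x - v" "(\<lambda>x. x - v) ` S" "y - v"] that by (auto intro: span_base)
  then show "directions S \<subseteq> span ((\<lambda>x. x - v) ` S)"
    unfolding directions_def by (intro span_minimal) auto
  show "span ((\<lambda>x. x - v) ` S) \<subseteq> directions S"
    by (intro span_minimal) (auto simp: subspace_directions diff_in_directions assms)
qed

lemma aff_dim_directions:
  assumes "S \<noteq> {}"
  shows "aff_dim S = int (dim (directions S))"
proof -
  obtain v where v: "v \<in> S"
    using assms by blast
  have "aff_dim S = int (dim ((\<lambda>x. x - v) ` S))"
    using aff_dim_eq_dim_subtract[of v S] v hull_inc by (metis)
  then show ?thesis
    by (simp add: directions_eq[OF v])
qed

lemma add_directions_in_affine_hull:
  assumes "x \<in> S" "d \<in> directions S"
  shows "x + d \<in> affine hull S"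
proof -
  have "d \<in> (\<lambda>y. y - x) ` (affine hull S)"
    using assms diffs_affine_hull_span directions_eq by metis
  then show ?thesis
    by auto
qed

lemma directions_linear_eq_0:
  fixes f :: "'a::euclidean_space \<Rightarrow> real"
  assumes "linear f" "\<And>x y. x \<in> S \<Longrightarrow> y \<in> S \<Longrightarrow> f x = f y" "d \<in> directions S"
  shows "f d = 0"
proof -
  have "directions S \<subseteq> {d. f d = 0}"
    unfolding directions_def
  proof (rule span_minimal)
    have "f (x - y) = 0" if "x \<in> S" "y \<in> S" for x y
      using assms(2)[OF that] by (simp add: linear_diff[OF assms(1)])
    then show "{x - y | x y. x \<in> S \<and> y \<in> S} \<subseteq> {d. f d = 0}"
      by blast
  qed (rule linear_subspace_kernel[OF assms(1)])
  with assms(3) show ?thesis by blast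
qed

lemma subspace_kernel_Int:
  fixes f :: "'a::real_vector \<Rightarrow> real"
  assumes "subspace S" "linear f"
  shows "subspace (S \<inter> {x. f x = 0})"
  using assms by (simp add: subspace_inter linear_subspace_kernel)

text \<open>\<open>x0\<close> spans a complement of the kernel in \<open>S\<close>: subtract from
  each \<open>z\<close> the multiple of \<open>x0\<close> with the same value of
  \<open>f\<close>.\<close>

lemma dim_Int_kernel:
  fixes f :: "'a::euclidean_space \<Rightarrow> real"
  assumes S: "subspace S" and f: "linear f" and x0: "x0 \<in> S" "f x0 \<noteq> 0"
  shows "dim (S \<inter> {x. f x = 0}) + 1 = dim S"
proof -
  let ?K = "S \<inter> {x. f x = 0}"
  have sum: "{x + y | x y. x \<in> ?K \<and> y \<in> span {x0}} = S"
  proof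
    show "{x + y | x y. x \<in> ?K \<and> y \<in> span {x0}} \<subseteq> S"
      using S x0 by (auto simp: span_singleton subspace_add subspace_mul)
    show "S \<subseteq> {x + y | x y. x \<in> ?K \<and> y \<in> span {x0}}"
    proof
      fix z assume z: "z \<in> S"
      let ?y = "(f z / f x0) *\<^sub>R x0"
      have "z - ?y \<in> ?K"
        using z x0 S f by (auto simp: subspace_diff subspace_mul linear_diff linear_cmul)
      moreover have "?y \<in> span {x0}"
        by (simp add: span_mul span_base)
      moreover have "z = (z - ?y) + ?y"
        by simp
      ultimately show "z \<in> {x + y | x y. x \<in> ?K \<and> y \<in> span {x0}}"
        by blast
    qed
  qed
  have "?K \<inter> span {x0} = {0}"
    using x0 f S by (auto simp: span_singleton linear_cmul linear_0 subspace_0)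
  moreover have "x0 \<noteq> 0"
    using x0 f linear_0 by metis
  ultimately show ?thesis
    using dim_sums_Int[of ?K "span {x0}"] sum subspace_kernel_Int[OF S f] by simp
qed

lemma exists_kernel_direction:
  fixes f :: "'a::euclidean_space \<Rightarrow> real"
  assumes "subspace S" "linear f" "dim S \<ge> 2"
  obtains d where "d \<in> S" "d \<noteq> 0" "f d = 0"
proof (cases "\<forall>x\<in>S. f x = 0")
  case True
  have "S \<noteq> {0}"
    using assms(3) by auto
  with True that assms(1) show ?thesis
    using subspace_0 by fastforce
next
  case False
  then have "dim (S \<inter> {x. f x = 0}) \<ge> 1"
    using dim_Int_kernel[OF assms(1,2)] assms(3) by fastforce
  then have "\<not> S \<inter> {x. f x = 0} \<subseteq> {0}"
    using dim_eq_0[of "S \<inter> {x. f x = 0}"] by linarith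
  then show ?thesis
    using that by auto
qed


section \<open>Optimality at a vertex tested along edges\<close>

text \<open>Near \<open>u\<close>, a polytope of dimension at least two is spanned by its proper faces through \<open>u\<close>:
  a segment in a level set of a functional exposing \<open>u\<close>, close to \<open>u\<close>, ends on such faces.\<close>

lemma polytope_ge_of_edges:
  fixes Q :: "'a::euclidean_space set" and f :: "'a \<Rightarrow> real"
  assumes "polytope Q" "u extreme_point_of Q" "linear f"
    and "\<And>E x. E edge_of Q \<Longrightarrow> u \<in> E \<Longrightarrow> x \<in> E \<Longrightarrow> f u \<le> f x"
    and "x \<in> Q"
  shows "f u \<le> f x"
  using assms
proof (induction "nat (aff_dim Q)" arbitrary: Q x rule: less_induct)
  case less
  have uQ: "u \<in> Q"
    using less.prems(2) by (simp add: extreme_point_of_def)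
  have conv: "convex Q" and bdd: "bounded Q" and poly: "polyhedron Q"
    using less.prems(1) polytope_imp_convex polytope_imp_bounded polytope_imp_polyhedron by auto
  have dimQ: "aff_dim Q = int (dim (directions Q))"
    using aff_dim_directions uQ by blast
  have IH: "f u \<le> f y" if G: "G face_of Q" "G \<noteq> Q" "u \<in> G" "y \<in> G" for G y
  proof (rule less.hyps[of G])
    have "G \<noteq> {}"
      using G(4) by blast
    then have "0 \<le> aff_dim G"
      by (simp add: aff_dim_directions)
    moreover have "aff_dim G < aff_dim Q"
      by (rule face_of_aff_dim_lt[OF conv G(1,2)])
    ultimately show "nat (aff_dim G) < nat (aff_dim Q)"
      by linarith
    show "polytope G" "u extreme_point_of G"
      using G less.prems face_of_polytope_polytope extreme_point_of_face by blast+
    show "\<And>E x. E edge_of G \<Longrightarrow> u \<in> E \<Longrightarrow> x \<in> E \<Longrightarrow> f u \<le> f x"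
      using less.prems(4) G(1) face_of_trans unfolding edge_of_def by blast
  qed (use G less.prems in auto)
  consider "aff_dim Q = 0" | "aff_dim Q = 1" | "aff_dim Q \<ge> 2"
    using dimQ by linarith
  then show ?case
  proof cases
    case 1
    then obtain q where "Q = {q}"
      using aff_dim_eq_0 by blast
    with uQ less.prems(5) show ?thesis
      by simp
  next
    case 2
    then have "Q edge_of Q"
      by (simp add: edge_of_def conv face_of_refl)
    then show ?thesis
      using less.prems uQ by blast
  next
    case 3
    have "{u} face_of Q"
      using less.prems(2) by (simp add: face_of_singleton)
    then obtain h :: "'a \<Rightarrow> real" and c where h: "linear h" "\<And>x. x \<in> Q \<Longrightarrow> c \<le> h x" "{u} = {x \<in> Q. h x = c}"
      using polytope_face_exposed[OF less.prems(1)] by metis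
    have hu: "h u = c" and hgt: "\<And>y. y \<in> Q \<Longrightarrow> y \<noteq> u \<Longrightarrow> c < h y"
      using h(2,3) by (auto simp: order.order_iff_strict)
    \<comment> \<open>A face that avoids \<open>u\<close> has all its vertices in \<open>V\<close>,
      so \<open>h\<close> is at least \<open>c'\<close> on it. Below the level \<open>c'\<close>
      only faces through \<open>u\<close> remain.\<close>
    define V where "V = {v. v extreme_point_of Q} - {u}"
    have "finite V"
      using finite_polyhedron_extreme_points[OF poly] by (simp add: V_def)
    moreover have "\<forall>v\<in>V. c < h v"
      using hgt by (auto simp: V_def extreme_point_of_def)
    ultimately obtain c' where c': "c < c'" "\<And>v. v \<in> V \<Longrightarrow> c' \<le> h v"
    proof (cases "V = {}")
      case False
      then show ?thesis
        using that[of "Min (h ` V)"] \<open>finite V\<close> \<open>\<forall>v\<in>V. c < h v\<close> by auto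
    qed (use that[of "c + 1"] in auto)
    have near: "f u \<le> f y" if y: "y \<in> rel_frontier Q" "h y < c'" for y
    proof -
      obtain G where G: "G face_of Q" "G \<noteq> Q" "y \<in> G"
        using y(1) rel_frontier_of_polyhedron_alt[OF poly] by blast
      have "u \<in> G"
      proof (rule ccontr)
        assume "u \<notin> G"
        then have "v \<in> V" if "v extreme_point_of G" for v
          using that extreme_point_of_face[OF G(1)] by (auto simp: V_def)
        then have "c' \<le> h y"
          using polytope_ge_of_vertices[of G h c' y] c' G h(1) face_of_polytope_polytope less.prems(1)
          by blast
        with y show False by simp
      qed
      with IH G show ?thesis by blast
    qed
    have small: "f u \<le> f y" if y: "y \<in> Q" "h y < c'" for y
    proof (cases "y \<in> rel_interior Q")
      case False
      then show ?thesis
        using near y closure_subset by (auto simp: rel_frontier_def)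
    next
      case True
      \<comment> \<open>Both ends of the chord through \<open>y\<close> along \<open>d\<close> have
        the same \<open>h\<close> as \<open>y\<close>, hence stay below \<open>c'\<close>. Whatever
        the sign of \<open>f d\<close>, one end has a value of \<open>f\<close> at most
        \<open>f y\<close>.\<close>
      obtain d where d: "d \<in> directions Q" "d \<noteq> 0" "h d = 0"
        using exists_kernel_direction[OF subspace_directions h(1), of Q] 3 dimQ by auto
      then have md: "-d \<in> directions Q"
        using subspace_directions subspace_neg by blast
      obtain s where s: "0 < s" "y + s *\<^sub>R d \<in> rel_frontier Q"
        using ray_to_rel_frontier[OF bdd True add_directions_in_affine_hull[OF y(1) d(1)] d(2)] by metis
      obtain t where t: "0 < t" "y + t *\<^sub>R (- d) \<in> rel_frontier Q"
        using ray_to_rel_frontier[OF bdd True add_directions_in_affine_hull[OF y(1) md]] d(2) by (metis neg_equal_0_iff_equal)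
      have "f u \<le> f (y + s *\<^sub>R d)" "f u \<le> f (y + t *\<^sub>R (- d))"
        using near s t y d h(1) by (auto simp: linear_add linear_cmul linear_neg linear_diff)
      then have *: "f u \<le> f y + s * f d" "f u \<le> f y - t * f d"
        using less.prems(3) by (auto simp: linear_add linear_cmul linear_neg linear_diff)
      show ?thesis
      proof (cases "f d \<le> 0")
        case True
        then have "s * f d \<le> 0"
          using s by (simp add: mult_nonneg_nonpos)
        with * show ?thesis by simp
      next
        case False
        then have "t * f d \<ge> 0"
          using t by simp
        with * show ?thesis by simp
      qed
    qed
    \<comment> \<open>The point at fraction \<open>e\<close> from \<open>u\<close> to
      \<open>x\<close> exceeds \<open>c\<close> in \<open>h\<close> by \<open>e * (h x - c)\<close>,
      which has to be less than \<open>c' - c\<close>. The summand \<open>2 * (c' - c)\<close> keeps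
      the denominator positive and \<open>e\<close> below 1. Linearity of \<open>f\<close> along the
      segment then carries the inequality on to \<open>x\<close>.\<close>
    define e where "e = (c' - c) / (2 * (c' - c) + (h x - c))"
    have hx: "c \<le> h x"
      using h less.prems(5) by blast
    have D: "0 < c' - c" "0 < 2 * (c' - c) + (h x - c)"
      using c'(1) hx by auto
    have e: "0 < e" "e \<le> 1"
      using D hx by (simp_all add: e_def)
    have "e * (h x - c) = (c' - c) * ((h x - c) / (2 * (c' - c) + (h x - c)))"
      by (simp add: e_def)
    also have "\<dots> < (c' - c) * 1"
      using D by (intro mult_strict_left_mono) (simp_all add: divide_less_eq)
    finally have e3: "e * (h x - c) < c' - c"
      by simp
    define y where "y = (1 - e) *\<^sub>R u + e *\<^sub>R x"
    have "y \<in> Q"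
      unfolding y_def using conv uQ less.prems(5) e by (intro convexD_alt) auto
    moreover have "h y < c'"
      unfolding y_def linear_affine_comb[OF h(1)] using e3 hu by (simp add: algebra_simps)
    ultimately have "f u \<le> f y"
      using small by blast
    then have "0 \<le> e * (f x - f u)"
      unfolding y_def linear_affine_comb[OF less.prems(3)] by (simp add: algebra_simps)
    then show ?thesis
      using e(1) by (simp add: zero_le_mult_iff)
  qed
qed

text \<open>Without an edge at \<open>u\<close> the edge criterion holds vacuously for every
  functional. Applied to the inner product with \<open>u - x\<close> it gives \<open>x = u\<close>
  for all \<open>x\<close> in \<open>Q\<close>, so \<open>Q\<close> is a point.\<close>

lemma polytope_edge_at_vertex:
  fixes Q :: "'a::euclidean_space set"
  assumes "polytope Q" "u extreme_point_of Q" "aff_dim Q \<ge> 1"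
  obtains E where "E edge_of Q" "u \<in> E"
proof (rule ccontr)
  assume "\<not> thesis"
  with that have no: "\<not> (E edge_of Q \<and> u \<in> E)" for E
    by blast
  have uQ: "u \<in> Q"
    using assms(2) by (simp add: extreme_point_of_def)
  have "x = u" if "x \<in> Q" for x
  proof -
    have "linear (\<lambda>y. (u - x) \<bullet> y)"
      by (simp add: bounded_linear.linear bounded_linear_inner_right)
    then have "(u - x) \<bullet> u \<le> (u - x) \<bullet> x"
    proof (rule polytope_ge_of_edges[OF assms(1,2) _ _ \<open>x \<in> Q\<close>])
      fix E z
      assume "E edge_of Q" "u \<in> E"
      with no show "(u - x) \<bullet> u \<le> (u - x) \<bullet> z"
        by simp
    qed
    then have "(u - x) \<bullet> (u - x) \<le> 0"
      by (simp add: inner_diff_right)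
    then show ?thesis
      using inner_ge_zero[of "u - x"] by (simp add: order.antisym)
  qed
  then have "Q = {u}"
    using uQ by blast
  then show False
    using assms(3) by simp
qed

subsection \<open>Polytopes with a generic functional\<close>

locale generic_polytope =
  fixes P :: "'a::euclidean_space set" and l :: "'a \<Rightarrow> real"
  assumes polytope: "polytope P"
    and linear: "linear l"
    and edge_nonconstant: "\<And>e. e edge_of P \<Longrightarrow> \<not> l constant_on e"
begin

text \<open>Reversing \<open>l\<close> exchanges minimal with maximal vertices and
  \<open>F_minus\<close> with \<open>F_plus\<close>, so facts about generic functionals are proved
  on one side only. The stratification concerns \<open>O_minus\<close> alone and is not covered by
  this symmetry.\<close>

lemma negated: "generic_polytope P (\<lambda>x. - l x)"
proof (rule generic_polytope.intro)
  show "linear (\<lambda>x. - l x)"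
    using linear by (rule linear_compose_neg)
  show "\<not> (\<lambda>x. - l x) constant_on e" if "e edge_of P" for e
    using edge_nonconstant[OF that] unfolding constant_on_def by (metis neg_equal_iff_equal)
qed (rule polytope)

lemma face_polytope: "F face_of P \<Longrightarrow> polytope F"
  using polytope face_of_polytope_polytope by blast

text \<open>A face of positive dimension has an edge, which is an edge of \<open>P\<close>, and
  \<open>l\<close> is not constant there. This is the source of all uniqueness of extremal
  vertices.\<close>

lemma face_constant_imp_singleton:
  assumes F: "F face_of P" and const: "\<And>x y. x \<in> F \<Longrightarrow> y \<in> F \<Longrightarrow> l x = l y"
    and xy: "x \<in> F" "y \<in> F"
  shows "x = y"
proof -
  have "\<not> aff_dim F \<ge> 1"
  proof
    assume dim: "aff_dim F \<ge> 1"
    obtain v where "v extreme_point_of F"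
      using polytope_has_vertex[OF face_polytope[OF F]] xy by blast
    then obtain E where E: "E edge_of F"
      using polytope_edge_at_vertex[OF face_polytope[OF F] _ dim] by blast
    then have "E edge_of P"
      using F face_of_trans unfolding edge_of_def by blast
    moreover have "l constant_on E"
      unfolding constant_on_def
    proof (intro exI ballI)
      fix z assume "z \<in> E"
      then show "l z = l x"
        using edge_of_imp_subset[OF E] const[OF _ xy(1)] by blast
    qed
    ultimately show False
      using edge_nonconstant by blast
  qed
  moreover have "F \<noteq> {}"
    using xy by blast
  then have "aff_dim F \<ge> 0"
    by (simp add: aff_dim_directions)
  ultimately have "aff_dim F = 0"
    by linarith
  then obtain q where "F = {q}"
    using aff_dim_eq_0 by blast
  with xy show ?thesis
    by simp
qed

lemma min_unique:
  assumes F: "F face_of P" and "x \<in> F" "y \<in> F"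
    and "\<And>z. z \<in> F \<Longrightarrow> l x \<le> l z" "\<And>z. z \<in> F \<Longrightarrow> l y \<le> l z"
  shows "x = y"
proof (rule face_constant_imp_singleton)
  have "convex F"
    using F face_of_imp_convex by blast
  then show "min_face l F face_of P"
    using min_face_face_of linear F face_of_trans by blast
  show "x \<in> min_face l F" "y \<in> min_face l F"
    using assms by (auto simp: min_face_def)
  show "l p = l q" if "p \<in> min_face l F" "q \<in> min_face l F" for p q
    using that by (simp add: min_face_def order.antisym)
qed

text \<open>Extremality is automatic: some vertex minimizes \<open>l\<close> on \<open>F\<close>,
  and the minimizer is unique.\<close>

lemma min_vertex_iff:
  assumes F: "F face_of P"
  shows "min_vertex l F v \<longleftrightarrow> v \<in> F \<and> (\<forall>x\<in>F. l v \<le> l x)"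
proof
  assume v: "v \<in> F \<and> (\<forall>x\<in>F. l v \<le> l x)"
  obtain w where w: "w extreme_point_of F" "\<And>x. x \<in> F \<Longrightarrow> l w \<le> l x"
    using polytope_min_vertex[OF face_polytope[OF F] _ linear] v by blast
  then have "w \<in> F"
    by (simp add: extreme_point_of_def)
  then have "v = w"
    using min_unique[OF F] v w by blast
  with w show "min_vertex l F v"
    by (simp add: min_vertex_def)
qed (auto simp: min_vertex_def extreme_point_of_def)

lemma min_vertex_exists:
  assumes "F face_of P" "F \<noteq> {}"
  obtains v where "min_vertex l F v"
proof -
  obtain v where "v extreme_point_of F" "\<And>x. x \<in> F \<Longrightarrow> l v \<le> l x"
    using polytope_min_vertex[OF face_polytope[OF assms(1)] assms(2) linear] by blast
  then show ?thesis
    by (intro that[of v]) (simp add: min_vertex_def)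
qed

lemma min_vertex_unique:
  assumes "F face_of P" "min_vertex l F u" "min_vertex l F v"
  shows "u = v"
  using min_unique[OF assms(1)] assms min_vertex_iff by blast

lemma max_vertex_neg: "max_vertex l F v \<longleftrightarrow> min_vertex (\<lambda>x. - l x) F v"
  by (simp add: max_vertex_def min_vertex_def)

lemma max_vertex_iff:
  assumes "F face_of P"
  shows "max_vertex l F v \<longleftrightarrow> v \<in> F \<and> (\<forall>x\<in>F. l x \<le> l v)"
  by (simp add: max_vertex_neg generic_polytope.min_vertex_iff[OF negated assms])

lemma max_vertex_exists:
  assumes "F face_of P" "F \<noteq> {}"
  obtains v where "max_vertex l F v"
  using generic_polytope.min_vertex_exists[OF negated assms] that unfolding max_vertex_neg by metis

lemma max_vertex_unique:
  assumes "F face_of P" "max_vertex l F u" "max_vertex l F v"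
  shows "u = v"
  using generic_polytope.min_vertex_unique[OF negated assms(1)] assms(2,3) unfolding max_vertex_neg by metis

lemma vertex_of_face: "F face_of P \<Longrightarrow> v extreme_point_of F \<Longrightarrow> v extreme_point_of P"
  using extreme_point_of_face by blast

text \<open>The relative interior of \<open>G\<close> belongs to \<open>O_minus P l v\<close> by
  definition, and a closed convex set is the closure of its relative interior.\<close>

lemma face_subset_F_minus:
  assumes "G face_of P" "v \<in> G" "\<And>x. x \<in> G \<Longrightarrow> l x \<le> l v"
  shows "G \<subseteq> F_minus P l v"
proof -
  have "rel_interior G \<subseteq> O_minus P l v"
    using assms by (auto simp: O_minus_def)
  moreover have "closure (rel_interior G) = G"
    using face_polytope[OF assms(1)]
    by (simp add: convex_closure_rel_interior polytope_imp_convex polytope_imp_closed)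
  ultimately show ?thesis
    unfolding F_minus_def using closure_mono by metis
qed

lemma vertex_in_F_minus:
  assumes "v extreme_point_of P"
  shows "v \<in> F_minus P l v"
  using face_subset_F_minus[of "{v}" v] assms by (simp add: face_of_singleton)

lemma F_minus_le:
  assumes "x \<in> F_minus P l v"
  shows "l x \<le> l v"
proof -
  have "O_minus P l v \<subseteq> {x. l x \<le> l v}"
    using rel_interior_subset by (auto simp: O_minus_def)
  moreover have "closed {x. l x \<le> l v}"
    using linear by (intro closed_Collect_le continuous_intros)
      (simp add: linear_continuous_on linear_conv_bounded_linear)
  ultimately have "F_minus P l v \<subseteq> {x. l x \<le> l v}"
    unfolding F_minus_def by (rule closure_minimal)
  with assms show ?thesis by blast
qed

lemma F_plus_neg: "F_plus P l v = F_minus P (\<lambda>x. - l x) v"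
  by (simp add: F_plus_def F_minus_def O_plus_def O_minus_def)

lemma face_subset_F_plus:
  assumes "G face_of P" "v \<in> G" "\<And>x. x \<in> G \<Longrightarrow> l v \<le> l x"
  shows "G \<subseteq> F_plus P l v"
  using generic_polytope.face_subset_F_minus[OF negated assms(1,2)] assms(3)
  by (simp add: F_plus_neg)

lemma F_plus_ge:
  assumes "x \<in> F_plus P l v"
  shows "l v \<le> l x"
  using generic_polytope.F_minus_le[OF negated, of x v] assms by (simp add: F_plus_neg)

text \<open>If \<open>l\<close> took values on both sides of \<open>l u\<close>, the point at height
  \<open>l u\<close> between \<open>y\<close> and \<open>x\<close> would be \<open>u\<close>,
  because the directions of an edge contain no nonzero vector with \<open>l = 0\<close>. An extreme
  point is not inside a segment of \<open>P\<close>.\<close>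

lemma edge_at_vertex_monotone:
  assumes E: "E edge_of P" and u: "u extreme_point_of P" "u \<in> E"
  shows "(\<forall>x\<in>E. l x \<le> l u) \<or> (\<forall>x\<in>E. l u \<le> l x)"
proof (rule ccontr)
  assume "\<not> ?thesis"
  then obtain x y where xy: "x \<in> E" "y \<in> E" "l u < l x" "l y < l u"
    by force
  define t where "t = (l u - l y) / (l x - l y)"
  have t: "0 < t" "t < 1"
    using xy by (auto simp: t_def)
  define p where "p = (1 - t) *\<^sub>R y + t *\<^sub>R x"
  have face: "E face_of P"
    using E by (simp add: edge_of_def)
  then have "convex E"
    by (rule face_of_imp_convex)
  then have p: "p \<in> E"
    unfolding p_def using xy t by (intro convexD_alt) auto
  have "l p = l y + t * (l x - l y)"
    unfolding p_def linear_affine_comb[OF linear] by (simp add: algebra_simps)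
  then have lp: "l p = l u"
    using xy by (simp add: t_def)
  have "l (x - y) \<noteq> 0" "x - y \<in> directions E"
    using xy by (auto simp: linear_diff[OF linear] diff_in_directions)
  then have "dim (directions E \<inter> {x. l x = 0}) + 1 = dim (directions E)"
    using dim_Int_kernel subspace_directions linear by blast
  moreover have "aff_dim E = int (dim (directions E))"
    using aff_dim_directions xy by blast
  ultimately have "dim (directions E \<inter> {x. l x = 0}) = 0"
    using E by (simp add: edge_of_def)
  moreover have "p - u \<in> directions E \<inter> {x. l x = 0}"
    using p u lp by (simp add: diff_in_directions linear_diff[OF linear])
  ultimately have "p = u"
    by (metis dim_eq_0 eq_iff_diff_eq_0 singletonD subsetD)
  moreover have "x \<noteq> y"
    using xy by auto
  ultimately have "u \<in> open_segment y x"
    using t p_def by (auto simp: in_segment)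
  moreover have "x \<in> P" "y \<in> P"
    using xy face face_of_imp_subset by blast+
  ultimately show False
    using u(1) by (auto simp: extreme_point_of_def)
qed

text \<open>Each edge of \<open>Q\<close> at \<open>u\<close> is monotone for \<open>l\<close>,
  hence contained in \<open>F_minus P l u\<close> or in \<open>F_plus P l u\<close>, and edges
  suffice by \<open>polytope_ge_of_edges\<close>. Later optimality proofs at a vertex reduce to
  these two faces in this way.\<close>

lemma ge_of_F_minus_F_plus:
  assumes Q: "Q face_of P" and u: "u extreme_point_of P" "u \<in> Q" and f: "linear f"
    and minus: "\<And>x. x \<in> Q \<Longrightarrow> x \<in> F_minus P l u \<Longrightarrow> f u \<le> (f x :: real)"
    and plus: "\<And>x. x \<in> Q \<Longrightarrow> x \<in> F_plus P l u \<Longrightarrow> f u \<le> f x"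
    and x: "x \<in> Q"
  shows "f u \<le> f x"
proof (rule polytope_ge_of_edges[OF face_polytope[OF Q] _ f _ x])
  show "u extreme_point_of Q"
    using extreme_point_of_face[OF Q] u by blast
  fix E y
  assume E: "E edge_of Q" "u \<in> E" "y \<in> E"
  then have EP: "E edge_of P"
    using Q face_of_trans unfolding edge_of_def by blast
  then have "E \<subseteq> F_minus P l u \<or> E \<subseteq> F_plus P l u"
    using edge_at_vertex_monotone[OF EP u(1) E(2)] face_subset_F_minus[of E u] face_subset_F_plus[of E u] E(2)
    unfolding edge_of_def by blast
  moreover have "y \<in> Q"
    using E edge_of_imp_subset by blast
  ultimately show "f u \<le> f y"
    using minus plus E(3) by blast
qed

end

section \<open>Consequences of the stratification: independent directions\<close>

locale stratified_polytope = generic_polytope +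
  assumes F_minus_face: "\<And>v. v extreme_point_of P \<Longrightarrow> F_minus P l v face_of P"
    and F_plus_face: "\<And>v. v extreme_point_of P \<Longrightarrow> F_plus P l v face_of P"
    and stratification: "O_minus_stratification P l"
begin

text \<open>The form in which the stratification is used. The face \<open>{u}\<close> puts
  \<open>u\<close> itself into \<open>O_minus P l u\<close>, so membership of \<open>u\<close> is
  enough for the two sets to meet.\<close>

lemma F_minus_mono:
  assumes u: "u extreme_point_of P" and v: "v extreme_point_of P" and uv: "u \<in> F_minus P l v"
  shows "F_minus P l u \<subseteq> F_minus P l v"
proof -
  have "rel_interior {u} \<subseteq> O_minus P l u"
    unfolding O_minus_def using u by (intro Union_upper CollectI exI[of _ "{u}"]) (simp add: face_of_singleton)
  with uv have "O_minus P l u \<inter> F_minus P l v \<noteq> {}"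
    by auto
  then have "O_minus P l u \<subseteq> F_minus P l v"
    using stratification u v by (auto simp: O_minus_stratification_def)
  then show ?thesis
    unfolding F_minus_def[of P l u] by (rule closure_minimal) (simp add: F_minus_def)
qed

text \<open>Let \<open>w\<close> be the lowest point of \<open>F\<close> inside
  \<open>F_minus P l u\<close>. By monotonicity, \<open>F_minus P l w\<close> stays inside
  \<open>F_minus P l u\<close>, so no edge of \<open>F\<close> descends from \<open>w\<close>. Thus
  \<open>w\<close> is lowest in all of \<open>F\<close> and equals \<open>v\<close>.\<close>

lemma min_vertex_in_F_minus:
  assumes F: "F face_of P" and v: "min_vertex l F v" and u: "u extreme_point_of P" "u \<in> F"
  shows "v \<in> F_minus P l u"
proof -
  have G: "F \<inter> F_minus P l u face_of P"
    by (intro face_of_Int F F_minus_face u)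
  have "F \<inter> F_minus P l u \<noteq> {}"
    using u vertex_in_F_minus by blast
  then obtain w where w: "min_vertex l (F \<inter> F_minus P l u) w"
    using min_vertex_exists[OF G] by blast
  then have wG: "w \<in> F" "w \<in> F_minus P l u" and wmin: "\<And>x. x \<in> F \<Longrightarrow> x \<in> F_minus P l u \<Longrightarrow> l w \<le> l x"
    using min_vertex_iff[OF G] by auto
  have wP: "w extreme_point_of P"
    using w vertex_of_face[OF G] by (simp add: min_vertex_def)
  have "l w \<le> l x" if "x \<in> F" for x
  proof (rule ge_of_F_minus_F_plus[OF F wP wG(1) linear _ _ that])
    show "l w \<le> l y" if "y \<in> F" "y \<in> F_minus P l w" for y
      using that wmin F_minus_mono[OF wP u(1) wG(2)] by blast
  qed (rule F_plus_ge)
  then have "w = v"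
    using min_vertex_unique[OF F] v wG min_vertex_iff[OF F] by blast
  with wG show ?thesis by simp
qed

text \<open>The ray from \<open>w\<close> through a relatively interior point \<open>x\<close>
  leaves \<open>F\<close> in a facet. If that facet contained \<open>w\<close>, it would contain
  \<open>x\<close>, which lies in between. The assumption \<open>v \<noteq> w\<close> says that
  \<open>F\<close> is not a point.\<close>

lemma facet_avoiding_max_vertex:
  assumes F: "F face_of P" and v: "v \<in> F" and w: "max_vertex l F w" and "v \<noteq> w"
  obtains G where "G facet_of F" "w \<notin> G"
proof -
  have wF: "w extreme_point_of F" "w \<in> F"
    using w by (auto simp: max_vertex_def extreme_point_of_def)
  have conv: "convex F" and bdd: "bounded F" and poly: "polyhedron F"
    using face_polytope[OF F] polytope_imp_convex polytope_imp_bounded polytope_imp_polyhedron by auto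
  have "rel_interior F \<noteq> {}"
    using rel_interior_eq_empty[OF conv] v by blast
  then obtain x where x: "x \<in> rel_interior F"
    by blast
  then have xF: "x \<in> F"
    using rel_interior_subset by blast
  have "{w} face_of F"
    using wF by (simp add: face_of_singleton)
  moreover have "{w} \<noteq> F"
    using v \<open>v \<noteq> w\<close> by auto
  ultimately have xw: "x \<noteq> w"
    using face_of_disjoint_rel_interior x by blast
  have "x + (x - w) \<in> affine hull F"
    using add_directions_in_affine_hull[OF xF] diff_in_directions xF wF by blast
  then obtain d where d: "0 < d" "x + d *\<^sub>R (x - w) \<in> rel_frontier F"
    using ray_to_rel_frontier[OF bdd x, of "x - w"] xw by auto
  then obtain G where G: "G facet_of F" "x + d *\<^sub>R (x - w) \<in> G"
    using rel_frontier_of_polyhedron[OF poly] by blast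
  have "w \<notin> G"
  proof
    assume "w \<in> G"
    have GF: "G face_of F" "G \<noteq> F"
      using G(1) by (auto simp: facet_of_def)
    \<comment> \<open>Solves for \<open>x\<close> as a convex combination of \<open>w\<close> and
      the exit point.\<close>
    define t where "t = 1 / (1 + d)"
    have t: "0 \<le> t" "t \<le> 1" "t + t * d = 1"
      using d by (auto simp: t_def field_simps)
    have "(1 - t) *\<^sub>R w + t *\<^sub>R (x + d *\<^sub>R (x - w)) \<in> G"
      using face_of_imp_convex[OF GF(1)] \<open>w \<in> G\<close> G(2) t by (intro convexD_alt) auto
    also have "(1 - t) *\<^sub>R w + t *\<^sub>R (x + d *\<^sub>R (x - w)) = (1 - (t + t * d)) *\<^sub>R w + (t + t * d) *\<^sub>R x"
      by (simp add: algebra_simps)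
    also have "\<dots> = x"
      by (simp add: t(3))
    finally show False
      using face_of_disjoint_rel_interior[OF GF] x by blast
  qed
  with G that show ?thesis by blast
qed

text \<open>Induction over a facet \<open>G\<close> of \<open>F\<close> that avoids the maximal vertex of \<open>F\<close>. If \<open>u\<close> is the maximal
  vertex of \<open>G\<close>, then \<open>G = F \<inter> F_minus P l u\<close>, and \<open>F_minus P l v \<subseteq> F_minus P l u\<close>; a functional exposing
  \<open>F_minus P l u\<close> therefore shows that common directions of \<open>F\<close> and \<open>F_minus P l v\<close> are directions of \<open>G\<close>.\<close>

lemma directions_Int_F_minus:
  assumes "F face_of P" "min_vertex l F v"
  shows "directions F \<inter> directions (F_minus P l v) = {0}"
  using assms
proof (induction "nat (aff_dim F)" arbitrary: F rule: less_induct)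
  case less
  note F = less.prems(1)
  have v: "v \<in> F" "v extreme_point_of P" "\<And>x. x \<in> F \<Longrightarrow> l v \<le> l x"
    using less.prems vertex_of_face by (auto simp: min_vertex_def extreme_point_of_def)
  obtain w where w: "max_vertex l F w"
    using max_vertex_exists[OF F] v by blast
  then have wF: "w \<in> F" "\<And>x. x \<in> F \<Longrightarrow> l x \<le> l w"
    using max_vertex_iff[OF F] by auto
  have zero: "0 \<in> directions F \<inter> directions (F_minus P l v)"
    using subspace_0 subspace_directions by blast
  show ?case
  proof (cases "v = w")
    case True
    have const: "l x = l v" if "x \<in> F" for x
      using v(3)[OF that] wF(2)[OF that] True by simp
    have "x = v" if "x \<in> F" for x
      by (rule face_constant_imp_singleton[OF F _ that v(1)]) (simp add: const)
    then have "F = {v}"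
      using v by blast
    then have "directions F = {0}"
      by (simp add: directions_def)
    with zero show ?thesis by auto
  next
    case False
    obtain G where G: "G facet_of F" "w \<notin> G"
      using facet_avoiding_max_vertex[OF F v(1) w False] by blast
    then have GF: "G face_of F" "G \<noteq> {}" and Gdim: "aff_dim G = aff_dim F - 1"
      by (auto simp: facet_of_def)
    have GP: "G face_of P"
      using GF(1) F face_of_trans by blast
    obtain u where u: "max_vertex l G u"
      using max_vertex_exists[OF GP GF(2)] by blast
    then have uG: "u \<in> G" "\<And>x. x \<in> G \<Longrightarrow> l x \<le> l u"
      using max_vertex_iff[OF GP] by auto
    have uP: "u extreme_point_of P"
      using u vertex_of_face[OF GP] by (simp add: max_vertex_def)
    have GFu: "G \<subseteq> F_minus P l u"
      using face_subset_F_minus[OF GP] uG by blast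
    have uF: "u \<in> F"
      using uG GF face_of_imp_subset by blast
    have wu: "w \<notin> F_minus P l u"
    proof
      assume "w \<in> F_minus P l u"
      then have "l w \<le> l u"
        by (rule F_minus_le)
      then have "max_vertex l F u"
        using max_vertex_iff[OF F] uF wF(2) order_trans by blast
      then show False
        using max_vertex_unique[OF F w] uG G(2) by blast
    qed
    \<comment> \<open>This face of \<open>F\<close> misses \<open>w\<close>, hence is proper, and it
      contains the facet \<open>G\<close>; by dimension it is \<open>G\<close>.\<close>
    have H: "F \<inter> F_minus P l u face_of F"
      using face_of_subset[OF face_of_Int[OF F F_minus_face[OF uP]]] face_of_imp_subset[OF F] by blast
    have "aff_dim (F \<inter> F_minus P l u) < aff_dim F"
      using face_of_aff_dim_lt[OF face_of_imp_convex[OF F] H] wF wu by blast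
    moreover have "G face_of F \<inter> F_minus P l u"
      using face_of_subset[OF GF(1)] GFu face_of_imp_subset[OF GF(1)] by blast
    ultimately have Geq: "G = F \<inter> F_minus P l u"
      using face_of_aff_dim_lt[OF face_of_imp_convex[OF H]] Gdim by force
    have vu: "v \<in> F_minus P l u"
      using min_vertex_in_F_minus[OF F less.prems(2) uP uF] .
    have vG: "v \<in> G"
      using Geq vu v(1) by blast
    have "min_vertex l G v"
      using min_vertex_iff[OF GP] vG v(3) GF(1) face_of_imp_subset by blast
    moreover have "nat (aff_dim G) < nat (aff_dim F)"
      using Gdim aff_dim_directions[OF GF(2)] by linarith
    ultimately have IH: "directions G \<inter> directions (F_minus P l v) = {0}"
      using less.hyps GP by blast
    obtain f :: "'a \<Rightarrow> real" and c where f: "linear f" "F_minus P l u = {x \<in> P. f x = c}"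
      using polytope_face_exposed[OF polytope F_minus_face[OF uP]] by metis
    have const: "f x = f y" if "x \<in> F_minus P l u" "y \<in> F_minus P l u" for x y
      using that f(2) by simp
    have "w \<in> P"
      using wF F face_of_imp_subset by blast
    then have "f w \<noteq> f v"
      using wu vu f(2) by auto
    then have "f (w - v) \<noteq> 0" "w - v \<in> directions F"
      using wF v by (auto simp: linear_diff[OF f(1)] diff_in_directions)
    then have "dim (directions F \<inter> {x. f x = 0}) + 1 = dim (directions F)"
      using dim_Int_kernel subspace_directions f(1) by blast
    \<comment> \<open>Since \<open>f\<close> differs at \<open>w\<close> and \<open>v\<close>, its
      kernel has codimension one in \<open>directions F\<close>, just as \<open>directions G\<close>
      has. The latter is contained in the kernel, so the two coincide.\<close>
    then have dims: "dim (directions F \<inter> {x. f x = 0}) = dim (directions G)"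
      using Gdim aff_dim_directions[of F] aff_dim_directions[OF GF(2)] v(1) by fastforce
    have "directions G \<subseteq> directions F \<inter> {x. f x = 0}"
      using directions_mono[OF face_of_imp_subset[OF GF(1)]]
        directions_linear_eq_0[OF f(1) const] directions_mono[OF GFu] by blast
    then have Gker: "directions G = directions F \<inter> {x. f x = 0}"
      using subspace_dim_equal[OF subspace_directions subspace_kernel_Int[OF subspace_directions f(1)]]
        dims by simp
    have "directions (F_minus P l v) \<subseteq> {x. f x = 0}"
      using directions_mono[OF F_minus_mono[OF v(2) uP vu]] directions_linear_eq_0[OF f(1) const] by blast
    then show ?thesis
      using IH Gker by blast
  qed
qed

end

section \<open>Prescribing a functional on two independent subspaces\<close>

text \<open>The union of bases of \<open>S\<close> and \<open>T\<close> spans their sum and has no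
  more elements than its dimension, so it is independent and values on it are free.\<close>

lemma linear_extend_two:
  fixes f g :: "'a::euclidean_space \<Rightarrow> real"
  assumes S: "subspace S" and T: "subspace T" and ST: "S \<inter> T = {0}"
    and f: "linear f" and g: "linear g"
  obtains h where "linear h" "\<And>x. x \<in> S \<Longrightarrow> h x = f x" "\<And>x. x \<in> T \<Longrightarrow> h x = g x"
proof -
  obtain B where B: "B \<subseteq> S" "independent B" "S \<subseteq> span B" "card B = dim S"
    using basis_exists by blast
  obtain C where C: "C \<subseteq> T" "independent C" "T \<subseteq> span C" "card C = dim T"
    using basis_exists by blast
  let ?V = "{x + y | x y. x \<in> S \<and> y \<in> T}"
  have fin: "finite B" "finite C"
    using independent_bound[OF B(2)] independent_bound[OF C(2)] by auto
  have "?V \<subseteq> span (B \<union> C)"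
    using B(3) C(3) span_mono[of B "B \<union> C"] span_mono[of C "B \<union> C"] by (auto intro!: span_add)
  moreover have "B \<union> C \<subseteq> ?V"
  proof
    fix x assume "x \<in> B \<union> C"
    then have "x \<in> S \<or> x \<in> T"
      using B(1) C(1) by blast
    then show "x \<in> ?V"
      using subspace_0[OF S] subspace_0[OF T] by force
  qed
  moreover have "card (B \<union> C) \<le> dim ?V"
    using dim_sums_Int[OF S T] ST B(4) C(4) card_Un_le[of B C] by simp
  ultimately have indep: "independent (B \<union> C)"
    using card_le_dim_spanning[of "B \<union> C" ?V] fin by simp
  obtain h where h: "linear h" "\<forall>x\<in>B \<union> C. h x = (if x \<in> B then f x else g x)"
    using linear_independent_extend[OF indep, of "\<lambda>x. if x \<in> B then f x else g x"] by blast
  have "0 \<notin> B"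
    using B(2) dependent_zero by metis
  have BC: "x \<notin> B" if "x \<in> C" for x
  proof
    assume "x \<in> B"
    then have "x \<in> S \<inter> T"
      using that B(1) C(1) by auto
    then show False
      using ST \<open>0 \<notin> B\<close> \<open>x \<in> B\<close> by simp
  qed
  show ?thesis
  proof
    show "h x = f x" if "x \<in> S" for x
      using linear_eq_on_span[OF h(1) f, of B x] h(2) B(3) that by auto
    show "h x = g x" if "x \<in> T" for x
      using linear_eq_on_span[OF h(1) g, of C x] h(2) C(3) that BC by auto
  qed (rule h(1))
qed

text \<open>Finitely many such conditions hold together for large \<open>c\<close>; sufficiently
  large slopes are chosen this way.\<close>

lemma eventually_pos_affine:
  fixes a b :: real
  assumes "0 < b"
  shows "eventually (\<lambda>c. 0 < a + c * b) at_top"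
  using eventually_gt_at_top[of "(- a) / b"]
proof eventually_elim
  case (elim c)
  then have "- a < c * b"
    using assms by (simp only: pos_divide_less_eq)
  then show ?case by simp
qed

subsection \<open>Chains of faces and their coherence\<close>

text \<open>Recursive form of \<open>face_chain\<close> with free end points, so that chains can be
  shortened at either end in inductions. The empty chain joins a vertex to itself.\<close>

fun chain_between ::
    "'a::euclidean_space set \<Rightarrow> ('a \<Rightarrow> real) \<Rightarrow> 'a \<Rightarrow> 'a set list \<Rightarrow> 'a \<Rightarrow> bool" where
  "chain_between P l u [] w \<longleftrightarrow> u = w"
| "chain_between P l u (F # Fs) w \<longleftrightarrow> F face_of P \<and> aff_dim F \<ge> 1 \<and> min_vertex l F u \<and>
     (\<exists>v. max_vertex l F v \<and> chain_between P l v Fs w)"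

lemma chain_between_snoc:
  "chain_between P l u (Fs @ [F]) w \<longleftrightarrow>
     (\<exists>v. chain_between P l u Fs v \<and> F face_of P \<and> aff_dim F \<ge> 1 \<and> min_vertex l F v \<and> max_vertex l F w)"
  by (induction Fs arbitrary: u) auto

lemma chain_between_iff:
  assumes "Fs \<noteq> []"
  shows "chain_between P l u Fs w \<longleftrightarrow>
     (\<forall>F\<in>set Fs. F face_of P \<and> aff_dim F \<ge> 1) \<and>
     successively (\<lambda>F G. \<exists>v. max_vertex l F v \<and> min_vertex l G v) Fs \<and>
     min_vertex l (hd Fs) u \<and> max_vertex l (last Fs) w"
  using assms
proof (induction Fs arbitrary: u rule: induct_list012)
  case (3 F G Fs)
  then show ?case
    by (simp only: chain_between.simps(2)[of P l u F "G # Fs"] "3.IH"(2)) auto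
qed auto

lemma face_chain_iff:
  "face_chain P l Fs \<longleftrightarrow>
     Fs \<noteq> [] \<and> (\<exists>s t. min_vertex l P s \<and> max_vertex l P t \<and> chain_between P l s Fs t)"
  by (cases "Fs = []") (auto simp: face_chain_def chain_between_iff successively_conv_nth)

lemma chain_between_face:
  "chain_between P l u Fs w \<Longrightarrow> F \<in> set Fs \<Longrightarrow> F face_of P \<and> aff_dim F \<ge> 1"
  by (induction Fs arbitrary: u) auto

context stratified_polytope
begin

text \<open>Each face lies in \<open>F_minus\<close> of its own top vertex, and these sets increase
  along the chain.\<close>

lemma chain_subset_F_minus:
  assumes "chain_between P l u Fs w" "u extreme_point_of P" "F \<in> set Fs"
  shows "F \<subseteq> F_minus P l w"
  using assms
proof (induction Fs arbitrary: w rule: rev_induct)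
  case (snoc G Fs)
  then obtain v where v: "chain_between P l u Fs v" "G face_of P" "min_vertex l G v" "max_vertex l G w"
    by (auto simp: chain_between_snoc)
  have ext: "v extreme_point_of P" "w extreme_point_of P"
    using vertex_of_face[OF v(2)] v(3,4) by (auto simp: min_vertex_def max_vertex_def)
  have G: "G \<subseteq> F_minus P l w"
    using face_subset_F_minus[OF v(2)] max_vertex_iff[OF v(2)] v(4) by blast
  moreover have "v \<in> G"
    using v(2,3) min_vertex_iff by blast
  ultimately have "F_minus P l v \<subseteq> F_minus P l w"
    using F_minus_mono[OF ext] by blast
  with G snoc v(1) show ?case
    by auto
qed simp

text \<open>The functional \<open>\<mu>\<close> agrees with an earlier one on the directions of \<open>F_minus P l u\<close>, and is
  \<open>c l\<close> plus a functional exposing the last face on those of \<open>F_plus P l u\<close>, with a large slope \<open>c\<close>.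
  This is possible since the two spaces of directions are independent.\<close>

lemma chain_coherent:
  assumes "chain_between P l s Fs v" "s extreme_point_of P"
  shows "\<exists>\<mu>. linear \<mu> \<and> (\<forall>F\<in>set Fs. \<exists>c. min_face (\<lambda>x. \<mu> x - c * l x) (F_minus P l v) = F)"
  using assms
proof (induction Fs arbitrary: v rule: rev_induct)
  case Nil
  show ?case
    by (intro exI[of _ "\<lambda>x. 0"]) (simp add: linear_zero)
next
  case (snoc F Fs)
  then obtain u where u: "chain_between P l s Fs u" "F face_of P" "min_vertex l F u" "max_vertex l F v"
    by (auto simp: chain_between_snoc)
  note FP = u(2)
  have ext: "u extreme_point_of P" "v extreme_point_of P"
    using vertex_of_face[OF FP] u(3,4) by (auto simp: min_vertex_def max_vertex_def)
  have F: "u \<in> F" "\<And>x. x \<in> F \<Longrightarrow> l u \<le> l x" "v \<in> F" "\<And>x. x \<in> F \<Longrightarrow> l x \<le> l v"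
    using u(3,4) min_vertex_iff[OF FP] max_vertex_iff[OF FP] by auto
  define A where "A = F_minus P l u"
  define B where "B = F_plus P l u"
  define Q where "Q = F_minus P l v"
  have AP: "A face_of P" and BP: "B face_of P" and QP: "Q face_of P"
    using F_minus_face F_plus_face ext by (auto simp: A_def B_def Q_def)
  have FQ: "F \<subseteq> Q"
    unfolding Q_def using face_subset_F_minus[OF FP F(3)] F(4) by blast
  then have uQ: "u \<in> Q"
    using F(1) by blast
  have AQ: "A \<subseteq> Q"
    unfolding A_def Q_def using F_minus_mono[OF ext] uQ Q_def by blast
  have FB: "F \<subseteq> B"
    unfolding B_def using face_subset_F_plus[OF FP F(1)] F(2) by blast
  have uA: "u \<in> A"
    unfolding A_def using vertex_in_F_minus[OF ext(1)] .
  have uB: "u \<in> B"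
    using FB F(1) by blast
  have lA: "l x \<le> l u" if "x \<in> A" for x
    using that F_minus_le by (simp add: A_def)
  have lB: "l u \<le> l x" if "x \<in> B" for x
    using that F_plus_ge by (simp add: B_def)
  have "min_vertex l B u"
    using min_vertex_iff[OF BP] uB lB by blast
  then have disj: "directions A \<inter> directions B = {0}"
    using directions_Int_F_minus[OF BP] A_def by blast
  have QT: "x \<in> P" if "x \<in> Q" for x
    using that QP face_of_imp_subset by blast
  obtain \<mu>0 where mu0: "linear \<mu>0" "\<forall>G\<in>set Fs. \<exists>c. min_face (\<lambda>x. \<mu>0 x - c * l x) A = G"
    using snoc.IH[OF u(1) snoc.prems(2)] A_def by blast
  then obtain sl where sl: "\<And>G. G \<in> set Fs \<Longrightarrow> min_face (\<lambda>x. \<mu>0 x - sl G * l x) A = G"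
    by metis
  obtain \<eta> :: "'a \<Rightarrow> real" and e where eta: "linear \<eta>" "\<And>x. x \<in> P \<Longrightarrow> e \<le> \<eta> x" "F = {x \<in> P. \<eta> x = e}"
    using polytope_face_exposed[OF polytope FP] by metis
  have etau: "\<eta> u = e"
    using F(1) eta(3) by blast
  obtain \<nu> where nu: "linear \<nu>" "\<And>x. x \<in> directions A \<Longrightarrow> \<nu> x = \<mu>0 x"
      "\<And>x. x \<in> directions B \<Longrightarrow> \<nu> x = \<eta> x"
    using linear_extend_two[OF subspace_directions subspace_directions disj mu0(1) eta(1)] by metis
  \<comment> \<open>The penalty for leaving \<open>A\<close>: multiples of \<open>g\<close> do not
    affect differences on \<open>A\<close>, and they raise every vertex of \<open>Q\<close> outside
    \<open>A\<close>.\<close>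
  obtain g :: "'a \<Rightarrow> real" where g: "linear g" "\<And>x. x \<in> directions A \<Longrightarrow> g x = 0"
      "\<And>x. x \<in> directions B \<Longrightarrow> g x = l x"
    using linear_extend_two[OF subspace_directions subspace_directions disj linear_zero linear] by metis
  have nuA: "\<nu> x - \<nu> u = \<mu>0 x - \<mu>0 u" and gA: "g x = g u" if "x \<in> A" for x
    using nu(2)[OF diff_in_directions[OF that uA]] g(2)[OF diff_in_directions[OF that uA]]
    by (simp_all add: linear_diff nu(1) g(1) mu0(1))
  have nuB: "\<nu> x - \<nu> u = \<eta> x - \<eta> u" and gB: "g x - g u = l x - l u" if "x \<in> B" for x
    using nu(3)[OF diff_in_directions[OF that uB]] g(3)[OF diff_in_directions[OF that uB]]
    by (simp_all add: linear_diff nu(1) g(1) eta(1) linear)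
  have gQ: "g u \<le> g x" if "x \<in> Q" for x
  proof (rule ge_of_F_minus_F_plus[OF QP ext(1) uQ g(1) _ _ that])
    show "g u \<le> g y" if "y \<in> F_minus P l u" for y
      using gA that A_def by simp
    show "g u \<le> g y" if "y \<in> F_plus P l u" for y
      using gB[of y] lB[of y] that B_def by simp
  qed
  have gQ_eq: "x \<in> A" if x: "x \<in> Q" "g x = g u" for x
  proof -
    have E: "min_face g Q face_of P"
      using min_face_face_of[OF face_of_imp_convex[OF QP] g(1)] QP face_of_trans by blast
    have mem: "y \<in> min_face g Q \<longleftrightarrow> y \<in> Q \<and> g y = g u" for y
      using min_face_at[where f = g, OF uQ gQ] by simp
    \<comment> \<open>On the minimizing face of \<open>g\<close> the points in \<open>B\<close> have
      \<open>l = l u\<close>, because \<open>g\<close> and \<open>l\<close> differ by a constant on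
      \<open>B\<close>. So \<open>u\<close> is a highest point of that face, which therefore lies in
      \<open>A\<close>.\<close>
    have "- l u \<le> - l y" if "y \<in> min_face g Q" for y
    proof (rule ge_of_F_minus_F_plus[OF E ext(1) _ linear_compose_neg[OF linear] _ _ that])
      show "u \<in> min_face g Q"
        using mem uQ by blast
      show "- l u \<le> - l z" if "z \<in> F_minus P l u" for z
        using lA that A_def by simp
      show "- l u \<le> - l z" if "z \<in> min_face g Q" "z \<in> F_plus P l u" for z
        using gB[of z] that mem B_def by simp
    qed
    then show ?thesis
      unfolding A_def using face_subset_F_minus[OF E, of u] mem uQ x by auto
  qed
  \<comment> \<open>Two demands on \<open>c\<close>: \<open>u\<close> must become the only minimizer
    on \<open>A\<close> at slope \<open>c\<close> (\<open>VA\<close>), and the vertices of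
    \<open>Q\<close> outside \<open>A\<close> must be lifted above the earlier faces
    (\<open>VQ\<close>). Each is a finite set of strict inequalities with positive coefficient of
    \<open>c\<close>.\<close>
  define VA where "VA = {w. w extreme_point_of A} - {u}"
  define VQ where "VQ = {w. w extreme_point_of Q} - A"
  have fin: "finite VA" "finite VQ"
    using finite_polyhedron_extreme_points polytope_imp_polyhedron face_polytope AP QP
    by (auto simp: VA_def VQ_def)
  have VA: "l w < l u" if "w \<in> VA" for w
  proof -
    have "w \<in> A" "w \<noteq> u"
      using that by (auto simp: VA_def extreme_point_of_def)
    moreover have "max_vertex l A u"
      using max_vertex_iff[OF AP] uA lA by blast
    moreover have "max_vertex l A w" if "l w = l u"
      using max_vertex_iff[OF AP] \<open>w \<in> A\<close> lA that by simp
    ultimately show ?thesis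
      using max_vertex_unique[OF AP] lA[of w] by (metis order.order_iff_strict)
  qed
  have VQ: "g u < g w" if "w \<in> VQ" for w
  proof -
    have "w \<in> Q" "w \<notin> A"
      using that by (auto simp: VQ_def extreme_point_of_def)
    then show ?thesis
      using gQ gQ_eq by force
  qed
  have "eventually (\<lambda>c. \<forall>w\<in>VA. 0 < (\<mu>0 w - \<mu>0 u) + c * (l u - l w)) at_top"
    using fin(1) VA by (intro eventually_ball_finite ballI eventually_pos_affine) auto
  \<comment> \<open>\<open>SOME z. z \<in> G\<close> is a reference point of \<open>G\<close>: the
    functional tilted by \<open>sl G\<close> is constant on \<open>G\<close>, so any point
    serves.\<close>
  moreover have "eventually (\<lambda>c. \<forall>G\<in>set Fs. \<forall>w\<in>VQ. 0 <
      (\<nu> w - sl G * l w - (\<nu> (SOME z. z \<in> G) - sl G * l (SOME z. z \<in> G))) + c * (g w - g u)) at_top"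
    using fin(2) VQ by (intro eventually_ball_finite ballI eventually_pos_affine) auto
  ultimately have "eventually (\<lambda>c. (\<forall>w\<in>VA. 0 < (\<mu>0 w - \<mu>0 u) + c * (l u - l w)) \<and>
      (\<forall>G\<in>set Fs. \<forall>w\<in>VQ. 0 < (\<nu> w - sl G * l w -
        (\<nu> (SOME z. z \<in> G) - sl G * l (SOME z. z \<in> G))) + c * (g w - g u))) at_top"
    by (rule eventually_conj)
  then obtain c where c: "\<And>w. w \<in> VA \<Longrightarrow> 0 < (\<mu>0 w - \<mu>0 u) + c * (l u - l w)"
      "\<And>G w. G \<in> set Fs \<Longrightarrow> w \<in> VQ \<Longrightarrow> 0 < (\<nu> w - sl G * l w -
        (\<nu> (SOME z. z \<in> G) - sl G * l (SOME z. z \<in> G))) + c * (g w - g u)"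
    using eventually_happens[of _ "at_top :: real filter"] trivial_limit_at_top_linorder by blast
  define \<mu> where "\<mu> = (\<lambda>x. \<nu> x + c * g x)"
  have mu: "linear \<mu>"
    unfolding \<mu>_def using g(1)
    by (intro linear_compose_add nu(1)) (simp add: linear_iff algebra_simps)
  have lin: "linear (\<lambda>x. \<mu> x - a * l x)" for a
    using mu linear by (intro linear_compose_sub) (simp_all add: linear_iff algebra_simps)
  have last: "min_face (\<lambda>x. \<mu> x - c * l x) Q = F"
  proof -
    let ?f = "\<lambda>x. \<mu> x - c * l x"
    \<comment> \<open>On \<open>A\<close> the penalty is constant, so the earlier functional with
      slope \<open>c\<close> remains. On \<open>B\<close> the terms \<open>c * g\<close> and
      \<open>c * l\<close> cancel up to a constant, so only \<open>\<eta>\<close> remains.\<close>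
    have fA: "?f x - ?f u = (\<mu>0 x - \<mu>0 u) + c * (l u - l x)" if "x \<in> A" for x
      using nuA[OF that] gA[OF that] by (simp add: \<mu>_def algebra_simps)
    have fB: "?f x - ?f u = \<eta> x - e" if "x \<in> B" for x
    proof -
      have "?f x - ?f u = (\<nu> x - \<nu> u) + c * (g x - g u) - c * (l x - l u)"
        by (simp add: \<mu>_def algebra_simps)
      then show ?thesis
        using nuB[OF that] gB[OF that] etau by simp
    qed
    have vA: "w = u \<or> ?f u < ?f w" if "w extreme_point_of A" for w
    proof (cases "w = u")
      case False
      have "w \<in> A"
        using that by (simp add: extreme_point_of_def)
      moreover have "w \<in> VA"
        using that False by (simp add: VA_def)
      ultimately show ?thesis
        using fA[of w] c(1)[of w] by linarith
    qed simp
    have geA: "?f u \<le> ?f x" if "x \<in> A" for x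
      using polytope_ge_of_vertices[OF face_polytope[OF AP] lin _ that] vA by force
    have eqA: "x = u" if x: "x \<in> A" "?f x = ?f u" for x
    proof -
      let ?E = "min_face ?f A"
      have E: "?E face_of A"
        using min_face_face_of[OF face_of_imp_convex[OF AP] lin] .
      have mem: "y \<in> ?E \<longleftrightarrow> y \<in> A \<and> ?f y = ?f u" for y
        using min_face_at[where f = ?f, OF uA geA] by simp
      \<comment> \<open>\<open>u\<close> is the only vertex of the minimizing face, so
        \<open>l\<close> is at least \<open>l u\<close> there; but \<open>u\<close> is the unique
        highest point of \<open>A\<close>.\<close>
      have "l u \<le> l x"
      proof (rule polytope_ge_of_vertices[OF _ linear])
        show "polytope ?E"
          using E AP face_polytope face_of_trans by blast
        show "l u \<le> l w" if "w extreme_point_of ?E" for w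
        proof -
          have "w extreme_point_of A" "w \<in> ?E"
            using that extreme_point_of_face[OF E] by auto
          then have "w = u"
            using vA[of w] mem by force
          then show ?thesis by simp
        qed
        show "x \<in> ?E"
          using x mem by blast
      qed
      then have "max_vertex l A x" "max_vertex l A u"
        using max_vertex_iff[OF AP] x uA lA by (force intro: order_trans)+
      then show ?thesis
        using max_vertex_unique[OF AP] by blast
    qed
    have geQ: "?f u \<le> ?f x" if "x \<in> Q" for x
    proof (rule ge_of_F_minus_F_plus[OF QP ext(1) uQ lin _ _ that])
      show "?f u \<le> ?f y" if "y \<in> F_minus P l u" for y
        using geA that A_def by simp
      show "?f u \<le> ?f y" if "y \<in> Q" "y \<in> F_plus P l u" for y
        using fB[of y] eta(2)[OF QT, of y] that B_def by simp
    qed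
    let ?E = "min_face ?f Q"
    have E: "?E face_of P"
      using min_face_face_of[OF face_of_imp_convex[OF QP] lin] QP face_of_trans by blast
    have mem: "y \<in> ?E \<longleftrightarrow> y \<in> Q \<and> ?f y = ?f u" for y
      using min_face_at[where f = ?f, OF uQ geQ] by simp
    have uE: "u \<in> ?E"
      using mem uQ by blast
    \<comment> \<open>The face meets \<open>A\<close> only in \<open>u\<close>, so \<open>u\<close>
      is its lowest point. Hence the face lies in \<open>B\<close>, where the functional is
      \<open>\<eta>\<close> up to a constant.\<close>
    have "l u \<le> l y" if "y \<in> ?E" for y
    proof (rule ge_of_F_minus_F_plus[OF E ext(1) uE linear _ _ that])
      show "l u \<le> l z" if "z \<in> ?E" "z \<in> F_minus P l u" for z
        using eqA[of z] that mem A_def by simp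
      show "l u \<le> l z" if "z \<in> F_plus P l u" for z
        using lB that B_def by simp
    qed
    then have EB: "?E \<subseteq> B"
      unfolding B_def using face_subset_F_plus[OF E uE] by blast
    show ?thesis
    proof
      show "?E \<subseteq> F"
      proof
        fix x assume x: "x \<in> ?E"
        then have "\<eta> x = e" "x \<in> P"
          using fB[of x] EB mem QT by auto
        then show "x \<in> F"
          using eta(3) by blast
      qed
      show "F \<subseteq> ?E"
      proof
        fix x assume x: "x \<in> F"
        then have "?f x = ?f u"
          using fB[of x] FB eta(3) by auto
        then show "x \<in> ?E"
          using mem x FQ by blast
      qed
    qed
  qed
  have earlier: "min_face (\<lambda>x. \<mu> x - sl G * l x) Q = G" if G: "G \<in> set Fs" for G
  proof -
    let ?f = "\<lambda>x. \<mu> x - sl G * l x"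
    define z where "z = (SOME z. z \<in> G)"
    have "G \<noteq> {}"
      using chain_between_face[OF u(1) G] by auto
    then have zG: "z \<in> G"
      unfolding z_def by (simp add: some_in_eq)
    have GA: "G = min_face (\<lambda>x. \<mu>0 x - sl G * l x) A"
      using sl[OF G] by simp
    then have zA: "z \<in> A"
      using zG min_face_subset by blast
    then have zQ: "z \<in> Q"
      using AQ by blast
    have fA: "?f x - ?f z = (\<mu>0 x - sl G * l x) - (\<mu>0 z - sl G * l z)" if "x \<in> A" for x
      using nuA[OF that] nuA[OF zA] gA[OF that] gA[OF zA] by (simp add: \<mu>_def)
    have vQ: "?f z < ?f w" if "w \<in> VQ" for w
      using c(2)[OF G that] gA[OF zA] by (simp add: \<mu>_def z_def[symmetric] algebra_simps)
    have Gmem: "x \<in> G \<longleftrightarrow> x \<in> A \<and> ?f x = ?f z" and geA: "x \<in> A \<Longrightarrow> ?f z \<le> ?f x" for x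
    proof -
      have min: "\<mu>0 z - sl G * l z \<le> \<mu>0 y - sl G * l y" if "y \<in> A" for y
        using zG GA that by (auto simp: min_face_def)
      show "x \<in> A \<Longrightarrow> ?f z \<le> ?f x"
        using fA[of x] min[of x] by simp
      have "x \<in> G \<longleftrightarrow> x \<in> A \<and> \<mu>0 x - sl G * l x = \<mu>0 z - sl G * l z"
        using min_face_at[where f = "\<lambda>x. \<mu>0 x - sl G * l x", OF zA min] GA by blast
      then show "x \<in> G \<longleftrightarrow> x \<in> A \<and> ?f x = ?f z"
        using fA[of x] by auto
    qed
    have vertQ: "w \<in> A \<or> w \<in> VQ" if "w extreme_point_of Q" for w
      using that by (auto simp: VQ_def)
    have geQ: "?f z \<le> ?f x" if "x \<in> Q" for x
      using polytope_ge_of_vertices[OF face_polytope[OF QP] lin _ that] vertQ geA vQ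
      by (meson order.strict_implies_order)
    let ?E = "min_face ?f Q"
    have E: "?E face_of Q"
      using min_face_face_of[OF face_of_imp_convex[OF QP] lin] .
    have mem: "y \<in> ?E \<longleftrightarrow> y \<in> Q \<and> ?f y = ?f z" for y
      using min_face_at[where f = ?f, OF zQ geQ] by simp
    have "x \<in> A" if x: "x \<in> ?E" for x
    proof -
      \<comment> \<open>All vertices of this face lie in \<open>A\<close>, so \<open>g\<close> does
        not exceed \<open>g u\<close> on it, and \<open>gQ_eq\<close> puts the whole face into
        \<open>A\<close>.\<close>
      have "- g u \<le> - g x"
      proof (rule polytope_ge_of_vertices[OF _ linear_compose_neg[OF g(1)] _ x])
        show "polytope ?E"
          using E QP face_polytope face_of_trans by blast
        show "- g u \<le> - g w" if "w extreme_point_of ?E" for w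
        proof -
          have "w extreme_point_of Q" "w \<in> ?E"
            using that extreme_point_of_face[OF E] by auto
          then have "w \<in> A"
            using vertQ[of w] vQ[of w] mem by force
          then show ?thesis
            using gA by simp
        qed
      qed
      then show ?thesis
        using gQ_eq[of x] gQ[of x] x mem by force
    qed
    then show ?thesis
      using Gmem mem AQ by blast
  qed
  show ?case
    using mu last earlier unfolding Q_def by (intro exI[of _ \<mu>]) auto
qed

end

subsection \<open>The chain selected by a functional\<close>

context generic_polytope
begin

lemma linear_tilt: "linear \<mu> \<Longrightarrow> linear (\<lambda>x. \<mu> x - c * l x)"
  using linear by (simp add: linear_iff algebra_simps)

lemma tilted_min_face_face: "linear \<mu> \<Longrightarrow> min_face (\<lambda>x. \<mu> x - c * l x) P face_of P"
  using min_face_face_of[OF polytope_imp_convex[OF polytope] linear_tilt] .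

lemma face_of_itself: "P face_of P"
  by (simp add: face_of_refl polytope polytope_imp_convex)

lemma aff_dim_ge_1:
  assumes "x \<in> F" "y \<in> F" "x \<noteq> y"
  shows "aff_dim F \<ge> 1"
proof -
  have "x - y \<in> directions F" "x - y \<noteq> 0"
    using assms diff_in_directions by auto
  then have "dim (directions F) \<noteq> 0"
    using dim_eq_0[of "directions F"] by blast
  moreover have "aff_dim F = int (dim (directions F))"
    using assms aff_dim_directions by blast
  ultimately show ?thesis
    by linarith
qed

lemma min_less_max:
  assumes F: "F face_of P" "aff_dim F \<ge> 1" and u: "min_vertex l F u" and v: "max_vertex l F v"
  shows "l u < l v"
proof (rule ccontr)
  assume "\<not> l u < l v"
  then have const: "l x = l v" if "x \<in> F" for x
    using u v that min_vertex_iff[OF F(1)] max_vertex_iff[OF F(1)] by (meson dual_order.antisym le_less_trans not_le)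
  have vF: "v \<in> F"
    using v max_vertex_iff[OF F(1)] by blast
  have "x = v" if "x \<in> F" for x
    by (rule face_constant_imp_singleton[OF F(1) _ that vF]) (simp add: const)
  then have "F = {v}"
    using vF by blast
  with F(2) show False
    by simp
qed

text \<open>One step of the parametric simplex method: when the slope increases from \<open>c0\<close>, the vertex
  \<open>v\<close> stays optimal until the smallest slope of a segment from \<open>v\<close> to a higher vertex.\<close>

lemma tilted_face_step:
  assumes mu: "linear \<mu>"
    and v: "v \<in> min_face (\<lambda>x. \<mu> x - c0 * l x) P"
    and top: "\<And>x. x \<in> min_face (\<lambda>x. \<mu> x - c0 * l x) P \<Longrightarrow> l x \<le> l v"
    and t: "max_vertex l P t" "v \<noteq> t"
  obtains c1 w where "w extreme_point_of P" "l v < l w"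
    "w \<in> min_face (\<lambda>x. \<mu> x - c1 * l x) P" "min_vertex l (min_face (\<lambda>x. \<mu> x - c1 * l x) P) v"
proof -
  have vP: "v \<in> P" and v0: "\<And>x. x \<in> P \<Longrightarrow> \<mu> v - c0 * l v \<le> \<mu> x - c0 * l x"
    using v by (auto simp: min_face_def)
  define S where "S = {w. w extreme_point_of P \<and> l v < l w}"
  have "finite {w. w extreme_point_of P}"
    using finite_polyhedron_extreme_points polytope_imp_polyhedron polytope by blast
  then have fin: "finite S"
    by (rule rev_finite_subset) (auto simp: S_def)
  have "l v < l t"
  proof (rule ccontr)
    assume "\<not> l v < l t"
    then have "max_vertex l P v"
      using t(1) vP unfolding max_vertex_iff[OF face_of_itself] by (meson not_less order_trans)
    then show False
      using max_vertex_unique[OF face_of_itself t(1)] t(2) by blast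
  qed
  then have "t \<in> S"
    using t(1) by (simp add: S_def max_vertex_def)
  define slope where "slope = (\<lambda>w. (\<mu> w - \<mu> v) / (l w - l v))"
  define c1 where "c1 = Min (slope ` S)"
  have "c1 \<in> slope ` S"
    unfolding c1_def using fin \<open>t \<in> S\<close> by (intro Min_in) auto
  then obtain w where w: "w \<in> S" "c1 = slope w"
    by blast
  have c1_le: "c1 \<le> slope x" if "x \<in> S" for x
    unfolding c1_def using fin that by (intro Min_le) auto
  have wP: "w extreme_point_of P" "w \<in> P" "l v < l w"
    using w(1) by (auto simp: S_def extreme_point_of_def)
  have eqw: "\<mu> w - c1 * l w = \<mu> v - c1 * l v"
    using wP(3) unfolding w(2) slope_def by (simp add: field_simps)
  \<comment> \<open>Otherwise \<open>w\<close>, which ties with \<open>v\<close> at slope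
    \<open>c1\<close>, would be at least as good as \<open>v\<close> at slope \<open>c0\<close>,
    although it is higher.\<close>
  have "c0 < c1"
  proof (rule ccontr)
    assume "\<not> c0 < c1"
    then have "c1 * (l w - l v) \<le> c0 * (l w - l v)"
      using wP(3) by (intro mult_right_mono) auto
    then have "\<mu> w - c0 * l w \<le> \<mu> v - c0 * l v"
      using eqw by (simp add: algebra_simps)
    then have "w \<in> min_face (\<lambda>x. \<mu> x - c0 * l x) P"
      using v0 wP(2) by (auto simp: min_face_def intro: order_trans)
    then show False
      using top[of w] wP(3) by simp
  qed
  \<comment> \<open>Vertices above \<open>v\<close> are covered by the minimality of
    \<open>c1\<close>; against the others, raising the slope from \<open>c0\<close> can only favour
    \<open>v\<close>.\<close>
  have vert: "\<mu> v - c1 * l v \<le> \<mu> x - c1 * l x" if x: "x extreme_point_of P" for x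
  proof (cases "l v < l x")
    case True
    then have "c1 \<le> (\<mu> x - \<mu> v) / (l x - l v)"
      using c1_le[of x] x by (simp add: S_def slope_def)
    then have "c1 * (l x - l v) \<le> \<mu> x - \<mu> v"
      using True by (simp add: pos_le_divide_eq)
    then show ?thesis
      by (simp add: algebra_simps)
  next
    case False
    then have "(c1 - c0) * (l v - l x) \<ge> 0"
      using \<open>c0 < c1\<close> by simp
    moreover have "\<mu> v - c0 * l v \<le> \<mu> x - c0 * l x"
      using v0 x by (simp add: extreme_point_of_def)
    ultimately show ?thesis
      by (simp add: algebra_simps)
  qed
  have v1: "\<mu> v - c1 * l v \<le> \<mu> x - c1 * l x" if "x \<in> P" for x
    using polytope_ge_of_vertices[OF polytope linear_tilt[OF mu] vert that] .
  let ?F = "min_face (\<lambda>x. \<mu> x - c1 * l x) P"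
  have mem: "x \<in> ?F \<longleftrightarrow> x \<in> P \<and> \<mu> x - c1 * l x = \<mu> v - c1 * l v" for x
    using min_face_at[where f = "\<lambda>x. \<mu> x - c1 * l x", OF vP v1] by simp
  have "l v \<le> l x" if "x \<in> ?F" for x
  proof -
    have "(c1 - c0) * (l x - l v) \<ge> 0"
      using mem[of x] v0[of x] that by (simp add: algebra_simps)
    then show ?thesis
      using \<open>c0 < c1\<close> by (simp add: zero_le_mult_iff)
  qed
  moreover have "v \<in> ?F"
    using mem vP by blast
  ultimately have "min_vertex l ?F v"
    using min_vertex_iff[OF tilted_min_face_face[OF mu]] by blast
  moreover have "w \<in> ?F"
    using mem wP eqw by blast
  ultimately show ?thesis
    using that wP by blast
qed

text \<open>Iterates \<open>tilted_face_step\<close> from the top vertex of each new face. The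
  number of vertices above the current one decreases, since \<open>w\<close> is not above the new
  top vertex.\<close>

lemma tilted_chain_from:
  assumes mu: "linear \<mu>" and t: "max_vertex l P t"
    and "v \<in> min_face (\<lambda>x. \<mu> x - c0 * l x) P"
    and "\<And>x. x \<in> min_face (\<lambda>x. \<mu> x - c0 * l x) P \<Longrightarrow> l x \<le> l v"
  shows "\<exists>Fs. chain_between P l v Fs t \<and> (\<forall>F\<in>set Fs. \<exists>c. min_face (\<lambda>x. \<mu> x - c * l x) P = F)"
  using assms(3,4)
proof (induction "card {w. w extreme_point_of P \<and> l v < l w}" arbitrary: v c0 rule: less_induct)
  case less
  show ?case
  proof (cases "v = t")
    case True
    then show ?thesis
      by (intro exI[of _ "[]"]) simp
  next
    case False
    obtain c1 w where w: "w extreme_point_of P" "l v < l w"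
        "w \<in> min_face (\<lambda>x. \<mu> x - c1 * l x) P" "min_vertex l (min_face (\<lambda>x. \<mu> x - c1 * l x) P) v"
      using tilted_face_step[OF mu less.prems t False] by metis
    let ?F = "min_face (\<lambda>x. \<mu> x - c1 * l x) P"
    have F: "?F face_of P"
      using tilted_min_face_face[OF mu] .
    obtain v' where v': "max_vertex l ?F v'"
      using max_vertex_exists[OF F] w(3) by blast
    then have v'F: "v' \<in> ?F" "\<And>x. x \<in> ?F \<Longrightarrow> l x \<le> l v'"
      using max_vertex_iff[OF F] by auto
    have "v \<in> ?F"
      using w(4) min_vertex_iff[OF F] by blast
    then have dim: "aff_dim ?F \<ge> 1"
      using aff_dim_ge_1[OF _ w(3)] w(2) by blast
    have "finite {w. w extreme_point_of P}"
      using finite_polyhedron_extreme_points polytope_imp_polyhedron polytope by blast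
    then have "finite {w. w extreme_point_of P \<and> l v < l w}"
      by (rule rev_finite_subset) auto
    moreover have "{w. w extreme_point_of P \<and> l v' < l w} \<subset> {w. w extreme_point_of P \<and> l v < l w}"
    proof (intro psubsetI subsetI)
      show "{w. w extreme_point_of P \<and> l v' < l w} \<noteq> {w. w extreme_point_of P \<and> l v < l w}"
        using w(1,2) v'F(2)[OF w(3)] not_less by blast
    qed (use w(2) v'F(2)[OF w(3)] in simp)
    ultimately have "card {w. w extreme_point_of P \<and> l v' < l w} < card {w. w extreme_point_of P \<and> l v < l w}"
      by (rule psubset_card_mono)
    then obtain Fs where "chain_between P l v' Fs t" "\<forall>F\<in>set Fs. \<exists>c. min_face (\<lambda>x. \<mu> x - c * l x) P = F"
      using less.hyps[OF _ v'F] by blast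
    then show ?thesis
      using F dim w(4) v' by (intro exI[of _ "?F # Fs"]) auto
  qed
qed

lemma tilted_chain_exists:
  assumes mu: "linear \<mu>" and s: "min_vertex l P s" and t: "max_vertex l P t"
  obtains Fs where "chain_between P l s Fs t"
    "\<And>F. F \<in> set Fs \<Longrightarrow> \<exists>c. min_face (\<lambda>x. \<mu> x - c * l x) P = F"
proof -
  define V where "V = {w. w extreme_point_of P} - {s}"
  have fin: "finite V"
    using finite_polyhedron_extreme_points[OF polytope_imp_polyhedron[OF polytope]] by (simp add: V_def)
  have sP: "s \<in> P" "\<And>x. x \<in> P \<Longrightarrow> l s \<le> l x"
    using s min_vertex_iff[OF face_of_itself] by auto
  have "l s < l w" if "w \<in> V" for w
  proof -
    have w: "w \<in> P" "w \<noteq> s"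
      using that by (auto simp: V_def extreme_point_of_def)
    have "\<not> min_vertex l P w"
      using min_vertex_unique[OF face_of_itself s] w by blast
    then have "l w \<noteq> l s"
      using min_vertex_iff[OF face_of_itself] w sP by auto
    then show ?thesis
      using sP(2)[OF w(1)] by simp
  qed
  then have "eventually (\<lambda>c. \<forall>w\<in>V. 0 < (\<mu> w - \<mu> s) + c * (l w - l s)) at_top"
    using fin by (intro eventually_ball_finite ballI eventually_pos_affine) auto
  then obtain c where c: "\<And>w. w \<in> V \<Longrightarrow> 0 < (\<mu> w - \<mu> s) + c * (l w - l s)"
    using eventually_happens[of _ "at_top :: real filter"] trivial_limit_at_top_linorder by blast
  have "\<mu> s - (- c) * l s \<le> \<mu> w - (- c) * l w" if "w extreme_point_of P" for w
    using c[of w] that by (cases "w = s") (auto simp: V_def algebra_simps)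
  then have ge: "\<mu> s - (- c) * l s \<le> \<mu> x - (- c) * l x" if "x \<in> P" for x
    using polytope_ge_of_vertices[OF polytope linear_tilt[OF mu] _ that] by blast
  \<comment> \<open>One unit below a slope at which \<open>s\<close> is optimal: a tie with
    \<open>s\<close> at \<open>c0\<close> then forces \<open>l x \<le> l s\<close>, as the start of
    the chain requires.\<close>
  define c0 where "c0 = - c - 1"
  have ge0: "\<mu> s - c0 * l s \<le> \<mu> x - c0 * l x" if "x \<in> P" for x
    using ge[OF that] sP(2)[OF that] by (simp add: c0_def algebra_simps)
  have mem: "x \<in> min_face (\<lambda>x. \<mu> x - c0 * l x) P \<longleftrightarrow> x \<in> P \<and> \<mu> x - c0 * l x = \<mu> s - c0 * l s" for x
    using min_face_at[where f = "\<lambda>x. \<mu> x - c0 * l x", OF sP(1) ge0] by simp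
  have top: "l x \<le> l s" if "x \<in> min_face (\<lambda>x. \<mu> x - c0 * l x) P" for x
    using that mem[of x] ge[of x] by (simp add: c0_def algebra_simps)
  have "s \<in> min_face (\<lambda>x. \<mu> x - c0 * l x) P"
    using mem sP by blast
  then obtain Fs where "chain_between P l s Fs t"
      "\<forall>F\<in>set Fs. \<exists>c. min_face (\<lambda>x. \<mu> x - c * l x) P = F"
    using tilted_chain_from[OF mu t _ top] by metis
  then show ?thesis
    by (intro that[of Fs]) auto
qed

lemma segment_at_height:
  assumes "convex F" "u \<in> F" "v \<in> F" "l u \<le> h" "h \<le> l v" "l u < l v"
  obtains y where "y \<in> F" "l y = h"
proof -
  define e where "e = (h - l u) / (l v - l u)"
  have e: "0 \<le> e" "e \<le> 1"
    using assms by (auto simp: e_def)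
  have "(1 - e) *\<^sub>R u + e *\<^sub>R v \<in> F"
    using assms e by (intro convexD_alt) auto
  moreover have "l ((1 - e) *\<^sub>R u + e *\<^sub>R v) = l u + e * (l v - l u)"
    unfolding linear_affine_comb[OF linear] by (simp add: algebra_simps)
  moreover have "e * (l v - l u) = h - l u"
    using assms by (simp add: e_def)
  ultimately show ?thesis
    using that by fastforce
qed

lemma chain_covers:
  assumes "chain_between P l u Fs w" "Fs \<noteq> []" "l u \<le> h" "h \<le> l w"
  obtains F y where "F \<in> set Fs" "y \<in> F" "l y = h"
  using assms
proof (induction Fs arbitrary: u thesis)
  case (Cons F Fs)
  obtain v where v: "max_vertex l F v" "chain_between P l v Fs w"
    using Cons.prems by auto
  have F: "F face_of P" "aff_dim F \<ge> 1" "min_vertex l F u"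
    using Cons.prems by auto
  show ?case
  proof (cases "h \<le> l v")
    case True
    have "u \<in> F" "v \<in> F"
      using F(3) v(1) min_vertex_iff[OF F(1)] max_vertex_iff[OF F(1)] by auto
    then obtain y where "y \<in> F" "l y = h"
      using segment_at_height[OF face_of_imp_convex[OF F(1)] _ _ _ True min_less_max[OF F v(1)]]
        Cons.prems(4) by blast
    then show ?thesis
      using Cons.prems(1)[of F y] by simp
  next
    case False
    then have "Fs \<noteq> []"
      using v(2) Cons.prems(5) by auto
    then obtain G y where "G \<in> set Fs" "y \<in> G" "l y = h"
      using Cons.IH[OF _ v(2)] False Cons.prems(5) by (metis linear not_le order_less_imp_le)
    then show ?thesis
      using Cons.prems(1)[of G y] by simp
  qed
qed simp

lemma chain_mono:
  assumes "chain_between P l u Fs w"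
  shows "l u \<le> l w" "Fs \<noteq> [] \<Longrightarrow> l u < l w"
    "F \<in> set Fs \<Longrightarrow> x \<in> F \<Longrightarrow> l u \<le> l x \<and> l x \<le> l w"
proof -
  have "l u \<le> l w \<and> (Fs \<noteq> [] \<longrightarrow> l u < l w) \<and> (\<forall>F\<in>set Fs. \<forall>x\<in>F. l u \<le> l x \<and> l x \<le> l w)"
    using assms
  proof (induction Fs arbitrary: u)
    case (Cons G Gs)
    then obtain v where v: "max_vertex l G v" "chain_between P l v Gs w"
      by auto
    have G: "G face_of P" "aff_dim G \<ge> 1" "min_vertex l G u"
      using Cons.prems by auto
    have IH: "l v \<le> l w" "\<And>F x. F \<in> set Gs \<Longrightarrow> x \<in> F \<Longrightarrow> l v \<le> l x \<and> l x \<le> l w"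
      using Cons.IH[OF v(2)] by blast+
    have "l u < l v"
      using min_less_max[OF G v(1)] .
    moreover have "l u \<le> l x \<and> l x \<le> l v" if "x \<in> G" for x
      using that G v min_vertex_iff[OF G(1)] max_vertex_iff[OF G(1)] by blast
    ultimately show ?case
      using IH by (fastforce intro: order_trans)
  qed simp
  then show "l u \<le> l w" "Fs \<noteq> [] \<Longrightarrow> l u < l w"
    "F \<in> set Fs \<Longrightarrow> x \<in> F \<Longrightarrow> l u \<le> l x \<and> l x \<le> l w"
    by blast+
qed

text \<open>On a slice, \<open>\<mu>\<close> and \<open>\<mu> - c * l\<close> differ by a constant.
  A face supported with slope \<open>c\<close> therefore contains all minimizers of every slice that
  it meets, and the chain meets every slice.\<close>

lemma chain_Union_slices:
  assumes chain: "chain_between P l s Fs t" and "Fs \<noteq> []"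
    and s: "min_vertex l P s" and t: "max_vertex l P t"
    and supp: "\<And>F. F \<in> set Fs \<Longrightarrow> \<exists>c. min_face (\<lambda>x. \<mu> x - c * l x) P = F"
  shows "(\<Union>c. min_face \<mu> (P \<inter> {x. l x = c})) = \<Union> (set Fs)"
proof
  show "(\<Union>c. min_face \<mu> (P \<inter> {x. l x = c})) \<subseteq> \<Union> (set Fs)"
  proof
    fix x assume "x \<in> (\<Union>c. min_face \<mu> (P \<inter> {x. l x = c}))"
    then have x: "x \<in> P" "\<And>y. y \<in> P \<Longrightarrow> l y = l x \<Longrightarrow> \<mu> x \<le> \<mu> y"
      by (auto simp: min_face_def)
    have "l s \<le> l x" "l x \<le> l t"
      using s t x min_vertex_iff[OF face_of_itself] max_vertex_iff[OF face_of_itself] by auto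
    then obtain F y where F: "F \<in> set Fs" "y \<in> F" "l y = l x"
      using chain_covers[OF chain \<open>Fs \<noteq> []\<close>] by metis
    obtain c where c: "min_face (\<lambda>x. \<mu> x - c * l x) P = F"
      using supp[OF F(1)] by blast
    then have y: "y \<in> P" "\<And>z. z \<in> P \<Longrightarrow> \<mu> y - c * l y \<le> \<mu> z - c * l z"
      using F(2) by (auto simp: min_face_def)
    have "\<mu> x - c * l x \<le> \<mu> y - c * l y"
      using x(2)[OF y(1)] F(3) by simp
    then have "x \<in> min_face (\<lambda>x. \<mu> x - c * l x) P"
      using x(1) y(2) by (auto simp: min_face_def intro: order_trans)
    then show "x \<in> \<Union> (set Fs)"
      using c F(1) by blast
  qed
  show "\<Union> (set Fs) \<subseteq> (\<Union>c. min_face \<mu> (P \<inter> {x. l x = c}))"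
  proof
    fix x assume "x \<in> \<Union> (set Fs)"
    then obtain F where F: "F \<in> set Fs" "x \<in> F"
      by blast
    then obtain c where "min_face (\<lambda>x. \<mu> x - c * l x) P = F"
      using supp by blast
    with F(2) have x: "x \<in> P" "\<And>z. z \<in> P \<Longrightarrow> \<mu> x - c * l x \<le> \<mu> z - c * l z"
      by (auto simp: min_face_def)
    have "\<mu> x \<le> \<mu> z" if "z \<in> P" "l z = l x" for z
      using x(2)[OF that(1)] that(2) by simp
    then have "x \<in> min_face \<mu> (P \<inter> {y. l y = l x})"
      using x(1) by (auto simp: min_face_def)
    then show "x \<in> (\<Union>c. min_face \<mu> (P \<inter> {x. l x = c}))"
      by blast
  qed
qed

lemma chain_start_in_Union:
  assumes "chain_between P l u Fs w" "Fs \<noteq> []"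
  shows "u \<in> \<Union> (set Fs)"
  using assms by (cases Fs) (auto simp: min_vertex_def extreme_point_of_def)

text \<open>A relatively interior point of \<open>F\<close> close enough to \<open>u\<close> lies
  below the top of \<open>G\<close>, hence below all faces after \<open>G\<close>, so it must lie in
  \<open>G\<close>. A face containing a relatively interior point of \<open>F\<close> contains
  \<open>F\<close>.\<close>

lemma chain_hd_subset:
  assumes F: "chain_between P l u (F # Fs) w" and G: "chain_between P l u (G # Gs) w'"
    and sub: "\<Union> (set (F # Fs)) \<subseteq> \<Union> (set (G # Gs))"
  shows "F \<subseteq> G"
proof -
  have FP: "F face_of P" "aff_dim F \<ge> 1" "min_vertex l F u"
    using F by auto
  obtain v where v: "G face_of P" "aff_dim G \<ge> 1" "min_vertex l G u" "max_vertex l G v" "chain_between P l v Gs w'"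
    using G by auto
  have conv: "convex F"
    using FP(1) face_of_imp_convex by blast
  have u: "u \<in> F" "\<And>x. x \<in> F \<Longrightarrow> l u \<le> l x"
    using FP min_vertex_iff by auto
  then obtain z where z: "z \<in> rel_interior F"
    using rel_interior_eq_empty[OF conv] by blast
  then have zF: "z \<in> F"
    using rel_interior_subset by blast
  \<comment> \<open>Chosen so that \<open>e * (l z - l u) < l v - l u\<close>; the added 1 covers
    \<open>l z = l u\<close>, and the minimum with 1 keeps the point between \<open>u\<close> and
    \<open>z\<close>.\<close>
  define e where "e = min 1 ((l v - l u) / (2 * (1 + (l z - l u))))"
  have pos: "0 < l v - l u" "0 < 1 + (l z - l u)"
    using min_less_max[OF v(1-4)] u(2)[OF zF] by auto
  then have e: "0 < e" "e \<le> 1"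
    by (auto simp: e_def)
  have "e * (1 + (l z - l u)) \<le> (l v - l u) / (2 * (1 + (l z - l u))) * (1 + (l z - l u))"
    using pos by (intro mult_right_mono) (auto simp: e_def)
  also have "\<dots> = (l v - l u) / 2 / (1 + (l z - l u)) * (1 + (l z - l u))"
    by simp
  also have "\<dots> = (l v - l u) / 2"
    using pos(2) by (intro nonzero_eq_divide_eq[THEN iffD1]) auto
  finally have small: "e * (1 + (l z - l u)) < l v - l u"
    using pos by simp
  define y where "y = u - e *\<^sub>R (u - z)"
  have y: "y \<in> rel_interior F"
    unfolding y_def using rel_interior_convex_shrink[OF conv z u(1) e] .
  have "l y = l u + e * (l z - l u)"
    unfolding y_def by (simp add: linear_diff linear_cmul linear right_diff_distrib)
  then have "l y < l v"
    using small e by (simp add: algebra_simps)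
  moreover have "y \<in> \<Union> (set (G # Gs))"
    using y rel_interior_subset[of F] sub by auto
  ultimately have "y \<in> G"
    using chain_mono(3)[OF v(5)] by force
  then show ?thesis
    using subset_of_face_of[OF v(1) face_of_imp_subset[OF FP(1)]] y by blast
qed

text \<open>The union determines the first face by \<open>chain_hd_subset\<close> in both
  directions. The rest of the union is its part at or above the top of that face.\<close>

lemma chain_unique:
  assumes "chain_between P l u Fs w" "chain_between P l u Gs w" "\<Union> (set Fs) = \<Union> (set Gs)"
  shows "Fs = Gs"
  using assms
proof (induction Fs arbitrary: u Gs)
  case Nil
  then have "u = w"
    by simp
  then show ?case
    using chain_mono(2)[OF Nil.prems(2)] by auto
next
  case (Cons F Fs)
  have "Gs \<noteq> []"
    using Cons.prems(2) chain_mono(2)[OF Cons.prems(1)] by auto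
  then obtain G Gs' where Gs: "Gs = G # Gs'"
    by (cases Gs) auto
  have "F = G"
  proof
    show "F \<subseteq> G"
      using chain_hd_subset[OF Cons.prems(1)] Cons.prems(2,3) Gs by blast
    show "G \<subseteq> F"
      using chain_hd_subset[OF _ Cons.prems(1), of G Gs'] Cons.prems(2,3) Gs by blast
  qed
  obtain v where v: "F face_of P" "max_vertex l F v" "chain_between P l v Fs w"
    using Cons.prems(1) by auto
  obtain v' where v': "max_vertex l F v'" "chain_between P l v' Gs' w"
    using Cons.prems(2) Gs \<open>F = G\<close> by auto
  then have v2: "chain_between P l v Gs' w"
    using max_vertex_unique[OF v(1,2)] by blast
  \<comment> \<open>At or above the height \<open>l v\<close> the face \<open>F\<close> contributes
    only \<open>v\<close>, which belongs to the next face as well.\<close>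
  have tail: "\<Union> (set Hs) = {x \<in> \<Union> (set (F # Hs)). l v \<le> l x}" if Hs: "chain_between P l v Hs w" "Hs \<noteq> []" for Hs
  proof
    show "\<Union> (set Hs) \<subseteq> {x \<in> \<Union> (set (F # Hs)). l v \<le> l x}"
      using chain_mono(3)[OF Hs(1)] by auto
    show "{x \<in> \<Union> (set (F # Hs)). l v \<le> l x} \<subseteq> \<Union> (set Hs)"
    proof
      fix x assume x: "x \<in> {x \<in> \<Union> (set (F # Hs)). l v \<le> l x}"
      show "x \<in> \<Union> (set Hs)"
      proof (cases "x \<in> F")
        case True
        then have "max_vertex l F x"
          using max_vertex_iff[OF v(1)] v(2) x by (auto intro: order_trans)
        then have "x = v"
          using max_vertex_unique[OF v(1,2)] by blast
        then show ?thesis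
          using chain_start_in_Union[OF Hs] by blast
      qed (use x in auto)
    qed
  qed
  have "\<Union> (set Fs) = \<Union> (set Gs')"
  proof (cases "v = w")
    case True
    then have "Fs = []" "Gs' = []"
      using chain_mono(2)[OF v(3)] chain_mono(2)[OF v2] by auto
    then show ?thesis by simp
  next
    case False
    then have "Fs \<noteq> []" "Gs' \<noteq> []"
      using v(3) v2 by auto
    then show ?thesis
      using tail[OF v(3)] tail[OF v2] Cons.prems(3) unfolding Gs \<open>F = G\<close> by metis
  qed
  then show ?case
    using Cons.IH[OF v(3) v2] Gs \<open>F = G\<close> by simp
qed

end

text \<open>Equal annihilators mean equal orthogonal complements. This allows spaces of directions
  of averages to be compared by testing functionals on sections.\<close>

lemma subspace_eq_of_annihilators:
  fixes S T :: "'a::euclidean_space set"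
  assumes "subspace S" "subspace T"
    and "\<And>f :: 'a \<Rightarrow> real. linear f \<Longrightarrow> (\<forall>x\<in>S. f x = 0) \<longleftrightarrow> (\<forall>x\<in>T. f x = 0)"
  shows "S = T"
proof -
  have lin: "linear (\<lambda>x. a \<bullet> x)" for a :: 'a
    by (simp add: bounded_linear.linear bounded_linear_inner_right)
  have "S\<^sup>\<bottom> = T\<^sup>\<bottom>"
    using assms(3)[OF lin] by (auto simp: orthogonal_comp_def orthogonal_def inner_commute)
  then show ?thesis
    using orthogonal_comp_self assms(1,2) by metis
qed

subsection \<open>Sections and the monotone path polytope\<close>

text \<open>The segment from \<open>p\<close> to \<open>q\<close> parametrized by height; for
  \<open>p = q\<close> it is constant.\<close>

definition segment_path :: "('a::euclidean_space \<Rightarrow> real) \<Rightarrow> 'a \<Rightarrow> 'a \<Rightarrow> real \<Rightarrow> 'a" where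
  "segment_path l p q \<tau> = p + ((\<tau> - l p) / (l q - l p)) *\<^sub>R (q - p)"

definition join_paths :: "real \<Rightarrow> (real \<Rightarrow> 'a) \<Rightarrow> (real \<Rightarrow> 'a) \<Rightarrow> real \<Rightarrow> 'a" where
  "join_paths c \<gamma> \<delta> = (\<lambda>\<tau>. if \<tau> \<le> c then \<gamma> \<tau> else \<delta> \<tau>)"

text \<open>Sections with prescribed end points. The degenerate interval is allowed, so that the
  empty chain also has a path.\<close>

definition path_in :: "('a::euclidean_space \<Rightarrow> real) \<Rightarrow> 'a set \<Rightarrow> 'a \<Rightarrow> 'a \<Rightarrow> (real \<Rightarrow> 'a) \<Rightarrow> bool" where
  "path_in l U u w \<gamma> \<longleftrightarrow> l u \<le> l w \<and> continuous_on {l u..l w} \<gamma> \<and> \<gamma> (l u) = u \<and> \<gamma> (l w) = w \<and>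
     (\<forall>\<tau>\<in>{l u..l w}. \<gamma> \<tau> \<in> U \<and> l (\<gamma> \<tau>) = \<tau>)"

lemma path_in_mono: "path_in l U u w \<gamma> \<Longrightarrow> U \<subseteq> V \<Longrightarrow> path_in l V u w \<gamma>"
  by (auto simp: path_in_def)

lemma path_in_join:
  assumes "path_in l U u v \<gamma>" "path_in l U v w \<delta>"
  shows "path_in l U u w (join_paths (l v) \<gamma> \<delta>)"
proof -
  have "continuous_on {l u..l w} (join_paths (l v) \<gamma> \<delta>)"
    unfolding join_paths_def
  proof (rule continuous_on_cases_le)
    have "{\<tau> \<in> {l u..l w}. \<tau> \<le> l v} = {l u..l v}" "{\<tau> \<in> {l u..l w}. l v \<le> \<tau>} = {l v..l w}"
      using assms by (auto simp: path_in_def)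
    then show "continuous_on {\<tau> \<in> {l u..l w}. \<tau> \<le> l v} \<gamma>" "continuous_on {\<tau> \<in> {l u..l w}. l v \<le> \<tau>} \<delta>"
      using assms by (auto simp: path_in_def)
  qed (use assms in \<open>auto simp: path_in_def intro: continuous_on_id\<close>)
  moreover have le: "l u \<le> l v" "l v \<le> l w"
    using assms by (simp_all add: path_in_def)
  moreover have "join_paths (l v) \<gamma> \<delta> (l u) = u"
    using assms(1) by (simp add: path_in_def join_paths_def)
  moreover have "join_paths (l v) \<gamma> \<delta> (l w) = w"
  proof (cases "l w \<le> l v")
    case True
    then have "l w = l v"
      using le by simp
    moreover have "\<gamma> (l v) = v" "\<delta> (l v) = v" "\<delta> (l w) = w"
      using assms by (simp_all add: path_in_def)
    ultimately show ?thesis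
      by (simp add: join_paths_def)
  qed (use assms(2) in \<open>simp add: path_in_def join_paths_def\<close>)
  moreover have "join_paths (l v) \<gamma> \<delta> \<tau> \<in> U \<and> l (join_paths (l v) \<gamma> \<delta> \<tau>) = \<tau>" if "\<tau> \<in> {l u..l w}" for \<tau>
    using assms that by (cases "\<tau> \<le> l v") (simp_all add: path_in_def join_paths_def)
  ultimately show ?thesis
    by (simp add: path_in_def)
qed

lemma join_paths_le:
  fixes f :: "'a \<Rightarrow> real"
  assumes "\<And>\<tau>. a \<le> \<tau> \<Longrightarrow> \<tau> \<le> c \<Longrightarrow> f (\<gamma> \<tau>) \<le> f (\<gamma>' \<tau>)"
    and "\<And>\<tau>. c \<le> \<tau> \<Longrightarrow> \<tau> \<le> b \<Longrightarrow> f (\<delta> \<tau>) \<le> f (\<delta>' \<tau>)"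
    and "a \<le> \<tau>" "\<tau> \<le> b"
  shows "f (join_paths c \<gamma> \<delta> \<tau>) \<le> f (join_paths c \<gamma>' \<delta>' \<tau>)"
  using assms by (simp add: join_paths_def)

lemma segment_path_convex_comb:
  "segment_path l p q \<tau> = (1 - (\<tau> - l p) / (l q - l p)) *\<^sub>R p + ((\<tau> - l p) / (l q - l p)) *\<^sub>R q"
  unfolding segment_path_def by (simp add: scaleR_diff_left scaleR_diff_right)

lemma segment_path_in:
  assumes l: "linear l" and "convex F" "p \<in> F" "q \<in> F" and pq: "p = q \<or> l p < l q"
  shows "path_in l F p q (segment_path l p q)"
proof (cases "p = q")
  case True
  then show ?thesis
    using assms by (auto simp: path_in_def segment_path_def)
next
  case False
  then have less: "l p < l q"
    using pq by blast
  have "continuous_on {l p..l q} (\<lambda>\<tau>. p + ((\<tau> - l p) / (l q - l p)) *\<^sub>R (q - p))"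
    using less by (intro continuous_intros) auto
  then have "continuous_on {l p..l q} (segment_path l p q)"
    by (simp add: segment_path_def[abs_def])
  moreover have "segment_path l p q \<tau> \<in> F" "l (segment_path l p q \<tau>) = \<tau>" if "\<tau> \<in> {l p..l q}" for \<tau>
  proof -
    have "0 \<le> (\<tau> - l p) / (l q - l p)" "(\<tau> - l p) / (l q - l p) \<le> 1"
      using that less by auto
    then show "segment_path l p q \<tau> \<in> F"
      unfolding segment_path_convex_comb using assms by (intro convexD_alt) auto
    show "l (segment_path l p q \<tau>) = \<tau>"
      unfolding segment_path_def using less
      by (simp add: linear_add[OF l] linear_cmul[OF l] linear_diff[OF l])
  qed
  ultimately show ?thesis
    using less by (auto simp: path_in_def segment_path_def)
qed

lemma segment_path_le:
  fixes f :: "'a::euclidean_space \<Rightarrow> real"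
  assumes f: "linear f" and "f p \<le> f p'" "f q \<le> f q'" "l p' = l p" "l q' = l q"
    and "l p \<le> \<tau>" "\<tau> \<le> l q"
  shows "f (segment_path l p q \<tau>) \<le> f (segment_path l p' q' \<tau>)"
proof -
  define c where "c = (\<tau> - l p) / (l q - l p)"
  have "0 \<le> c" "c \<le> 1"
    using assms by (auto simp: c_def divide_le_eq_1)
  then have "(1 - c) * f p + c * f q \<le> (1 - c) * f p' + c * f q'"
    using assms by (intro add_mono mult_left_mono) auto
  then show ?thesis
    unfolding segment_path_convex_comb linear_affine_comb[OF f] assms(4,5) c_def .
qed

context generic_polytope
begin

lemma chain_path_exists:
  assumes "chain_between P l u Fs w"
  shows "\<exists>\<gamma>. path_in l (insert u (\<Union> (set Fs))) u w \<gamma>"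
  using assms
proof (induction Fs arbitrary: u)
  case Nil
  then show ?case
    by (intro exI[of _ "\<lambda>_. u"]) (simp add: path_in_def)
next
  case (Cons F Fs)
  obtain v where "max_vertex l F v" "chain_between P l v Fs w"
    using Cons.prems by auto
  then obtain \<gamma> where v: "max_vertex l F v" "path_in l (insert v (\<Union> (set Fs))) v w \<gamma>"
    using Cons.IH by blast
  have F: "F face_of P" "aff_dim F \<ge> 1" "min_vertex l F u"
    using Cons.prems by auto
  have uv: "u \<in> F" "v \<in> F"
    using F(3) v(1) min_vertex_iff[OF F(1)] max_vertex_iff[OF F(1)] by auto
  have "path_in l (\<Union> (set (F # Fs))) u v (segment_path l u v)"
    using segment_path_in[OF linear face_of_imp_convex[OF F(1)] uv] min_less_max[OF F v(1)]
    by (auto intro: path_in_mono)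
  moreover have "path_in l (\<Union> (set (F # Fs))) v w \<gamma>"
    using v(2) by (rule path_in_mono) (use uv in auto)
  ultimately have "path_in l (\<Union> (set (F # Fs))) u w (join_paths (l v) (segment_path l u v) \<gamma>)"
    by (rule path_in_join)
  then have "path_in l (insert u (\<Union> (set (F # Fs)))) u w (join_paths (l v) (segment_path l u v) \<gamma>)"
    by (rule path_in_mono) auto
  then show ?case by (intro exI)
qed

text \<open>Two points on the same level of a face of the chain lie on two paths that differ only inside
  this face, by a nonnegative multiple of the difference of the two points.\<close>

lemma chain_two_paths:
  assumes "chain_between P l u Fs w" "F \<in> set Fs" "x \<in> F" "y \<in> F" "l y = l x"
  shows "\<exists>\<gamma> \<delta>. path_in l (\<Union> (set Fs)) u w \<gamma> \<and> path_in l (\<Union> (set Fs)) u w \<delta> \<and>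
    \<gamma> (l x) = x \<and> \<delta> (l x) = y \<and>
    (\<forall>(f :: 'a \<Rightarrow> real) \<tau>. linear f \<and> f x \<le> f y \<and> l u \<le> \<tau> \<and> \<tau> \<le> l w \<longrightarrow> f (\<gamma> \<tau>) \<le> f (\<delta> \<tau>))"
  using assms(1,2)
proof (induction Fs arbitrary: u)
  case (Cons G Gs)
  obtain v where v: "max_vertex l G v" "chain_between P l v Gs w"
    using Cons.prems by auto
  have G: "G face_of P" "aff_dim G \<ge> 1" "min_vertex l G u"
    using Cons.prems by auto
  have conv: "convex G"
    using G(1) face_of_imp_convex by blast
  have uv: "u \<in> G" "v \<in> G" "\<And>z. z \<in> G \<Longrightarrow> l u \<le> l z" "\<And>z. z \<in> G \<Longrightarrow> l z \<le> l v"
    using G(3) v(1) min_vertex_iff[OF G(1)] max_vertex_iff[OF G(1)] by auto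
  have luv: "l u < l v"
    using min_less_max[OF G v(1)] .
  let ?U = "\<Union> (set (G # Gs))"
  have GU: "G \<subseteq> ?U"
    by auto
  show ?case
  proof (cases "F = G")
    case True
    have low: "u = z \<or> l u < l z" and high: "z = v \<or> l z < l v" if "z \<in> G" for z
    proof -
      have "min_vertex l G z" if "l z = l u"
        using min_vertex_iff[OF G(1)] \<open>z \<in> G\<close> uv(3) that by simp
      then show "u = z \<or> l u < l z"
        using min_vertex_unique[OF G(1,3)] uv(3)[OF that] by force
      have "max_vertex l G z" if "l z = l v"
        using max_vertex_iff[OF G(1)] \<open>z \<in> G\<close> uv(4) that by simp
      then show "z = v \<or> l z < l v"
        using max_vertex_unique[OF G(1) v(1)] uv(4)[OF that] by force
    qed
    obtain \<epsilon> where "path_in l (insert v (\<Union> (set Gs))) v w \<epsilon>"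
      using chain_path_exists[OF v(2)] by blast
    then have eps: "path_in l ?U v w \<epsilon>"
      by (rule path_in_mono) (use uv in auto)
    \<comment> \<open>Only the part inside \<open>G\<close> depends on \<open>z\<close>, and for two
      points of equal height the pieces are joined at the same parameters.\<close>
    define \<rho> where "\<rho> = (\<lambda>z. join_paths (l v) (join_paths (l z) (segment_path l u z) (segment_path l z v)) \<epsilon>)"
    have path: "path_in l ?U u w (\<rho> z)" if "z \<in> G" for z
    proof -
      have "path_in l ?U u z (segment_path l u z)" "path_in l ?U z v (segment_path l z v)"
        using path_in_mono[OF segment_path_in[OF linear conv uv(1) that low[OF that]] GU]
          path_in_mono[OF segment_path_in[OF linear conv that uv(2) high[OF that]] GU] .
      then have "path_in l ?U u v (join_paths (l z) (segment_path l u z) (segment_path l z v))"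
        by (rule path_in_join)
      then show ?thesis
        unfolding \<rho>_def using eps by (rule path_in_join)
    qed
    have pass: "\<rho> z (l z) = z" if "z \<in> G" for z
      using segment_path_in[OF linear conv uv(1) that low[OF that]] uv(4)[OF that]
      by (simp add: \<rho>_def join_paths_def path_in_def)
    have xy: "x \<in> G" "y \<in> G"
      using True assms by auto
    have le: "f (\<rho> x \<tau>) \<le> f (\<rho> y \<tau>)"
      if f: "linear f" "f x \<le> f y" and \<tau>: "l u \<le> \<tau>" "\<tau> \<le> l w" for f :: "'a \<Rightarrow> real" and \<tau>
      unfolding \<rho>_def assms(5)
    proof (rule join_paths_le[where a = "l u" and b = "l w"])
      fix \<sigma> assume "l u \<le> \<sigma>" "\<sigma> \<le> l v"
      then show "f (join_paths (l x) (segment_path l u x) (segment_path l x v) \<sigma>)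
          \<le> f (join_paths (l x) (segment_path l u y) (segment_path l y v) \<sigma>)"
      proof (rule join_paths_le[rotated 2])
        show "f (segment_path l u x \<kappa>) \<le> f (segment_path l u y \<kappa>)" if "l u \<le> \<kappa>" "\<kappa> \<le> l x" for \<kappa>
          using segment_path_le[OF f(1) order_refl f(2) refl assms(5) that] .
        show "f (segment_path l x v \<kappa>) \<le> f (segment_path l y v \<kappa>)" if "l x \<le> \<kappa>" "\<kappa> \<le> l v" for \<kappa>
          using segment_path_le[OF f order_refl assms(5) refl that] .
      qed
    qed (use \<tau> in auto)
    show ?thesis
    proof (intro exI conjI allI impI)
      show "path_in l ?U u w (\<rho> x)" "path_in l ?U u w (\<rho> y)" "\<rho> x (l x) = x" "\<rho> y (l x) = y"
        using path[OF xy(1)] path[OF xy(2)] pass[OF xy(1)] pass[OF xy(2)] assms(5) by auto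
    qed (use le in blast)
  next
    case False
    then have F: "F \<in> set Gs"
      using Cons.prems by auto
    obtain \<gamma> \<delta> where IH: "path_in l (\<Union> (set Gs)) v w \<gamma>" "path_in l (\<Union> (set Gs)) v w \<delta>"
        "\<gamma> (l x) = x" "\<delta> (l x) = y"
        "\<And>(f :: 'a \<Rightarrow> real) \<tau>. linear f \<Longrightarrow> f x \<le> f y \<Longrightarrow> l v \<le> \<tau> \<Longrightarrow> \<tau> \<le> l w \<Longrightarrow> f (\<gamma> \<tau>) \<le> f (\<delta> \<tau>)"
      using Cons.IH[OF v(2) F] by blast
    have lvx: "l v \<le> l x"
      using chain_mono(3)[OF v(2) F assms(3)] by blast
    let ?J = "join_paths (l v) (segment_path l u v)"
    have seg: "path_in l ?U u v (segment_path l u v)"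
      using path_in_mono[OF segment_path_in[OF linear conv uv(1,2)] GU] luv by blast
    have UU: "\<Union> (set Gs) \<subseteq> ?U"
      by auto
    have paths: "path_in l ?U u w (?J \<gamma>)" "path_in l ?U u w (?J \<delta>)"
      using path_in_join[OF seg path_in_mono[OF IH(1) UU]] path_in_join[OF seg path_in_mono[OF IH(2) UU]] .
    have ends: "segment_path l u v (l v) = v" "\<gamma> (l v) = v" "\<delta> (l v) = v"
      using seg IH(1,2) by (simp_all add: path_in_def)
    have J: "?J \<phi> (l x) = \<phi> (l x)" if "\<phi> (l v) = v" for \<phi>
    proof (cases "l v = l x")
      case True
      show ?thesis
        unfolding True[symmetric] by (simp add: join_paths_def ends(1) that)
    next
      case False
      then have "\<not> l x \<le> l v"
        using lvx by simp
      then show ?thesis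
        by (simp add: join_paths_def)
    qed
    then have pass: "?J \<gamma> (l x) = x" "?J \<delta> (l x) = y"
      using J[of \<gamma>, OF ends(2)] J[of \<delta>, OF ends(3)] IH(3,4) by simp_all
    have le: "f (?J \<gamma> \<tau>) \<le> f (?J \<delta> \<tau>)"
      if "linear f" "f x \<le> f y" "l u \<le> \<tau>" "\<tau> \<le> l w" for f :: "'a \<Rightarrow> real" and \<tau>
      by (rule join_paths_le[where a = "l u" and b = "l w"])
        (rule order_refl, rule IH(5)[OF that(1,2)], assumption+, rule that(3), rule that(4))
    show ?thesis
    proof (intro exI conjI allI impI)
      show "path_in l ?U u w (?J \<gamma>)" "path_in l ?U u w (?J \<delta>)" "?J \<gamma> (l x) = x" "?J \<delta> (l x) = y"
        using paths pass by auto
    qed (use le in blast)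
  qed
qed simp

text \<open>Points of \<open>G\<close> and of a later face can have equal height only if the first
  is the top vertex of \<open>G\<close>, which also belongs to the later part of the chain.\<close>

lemma chain_slice_in_face:
  assumes "chain_between P l u Fs w" "x \<in> \<Union> (set Fs)" "y \<in> \<Union> (set Fs)" "l x = l y"
  shows "\<exists>F\<in>set Fs. x \<in> F \<and> y \<in> F"
proof -
  have gen: "\<forall>x y. x \<in> \<Union> (set Fs) \<longrightarrow> y \<in> \<Union> (set Fs) \<longrightarrow> l x = l y \<longrightarrow> (\<exists>F\<in>set Fs. x \<in> F \<and> y \<in> F)"
    using assms(1)
  proof (induction Fs arbitrary: u)
    case (Cons G Gs)
    obtain v where v: "max_vertex l G v" "chain_between P l v Gs w"
      using Cons.prems by auto
    have G: "G face_of P"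
      using Cons.prems by auto
    have IH: "\<exists>F\<in>set Gs. x \<in> F \<and> y \<in> F" if "x \<in> \<Union> (set Gs)" "y \<in> \<Union> (set Gs)" "l x = l y" for x y
      using Cons.IH[OF v(2)] that by blast
    have mixed: "\<exists>F\<in>set Gs. x \<in> F \<and> y \<in> F" if xy: "x \<in> G" "y \<in> \<Union> (set Gs)" "l x = l y" for x y
    proof -
      have "l v \<le> l y"
        using chain_mono(3)[OF v(2)] xy(2) by blast
      then have "max_vertex l G x"
        using max_vertex_iff[OF G] v(1) xy by (auto intro: order_trans)
      then have "x = v"
        using max_vertex_unique[OF G] v(1) by blast
      moreover have "v \<in> \<Union> (set Gs)"
        using chain_start_in_Union[OF v(2)] xy(2) by force
      ultimately show ?thesis
        using IH xy by blast
    qed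
    show ?case
    proof (intro allI impI)
      fix x y assume xy: "x \<in> \<Union> (set (G # Gs))" "y \<in> \<Union> (set (G # Gs))" "l x = l y"
      consider "x \<in> G" "y \<in> G" | "x \<in> G" "y \<in> \<Union> (set Gs)" | "y \<in> G" "x \<in> \<Union> (set Gs)"
        | "x \<in> \<Union> (set Gs)" "y \<in> \<Union> (set Gs)"
        using xy by auto
      then show "\<exists>F\<in>set (G # Gs). x \<in> F \<and> y \<in> F"
      proof cases
        case 2
        then show ?thesis
          using mixed[OF 2 xy(3)] by auto
      next
        case 3
        then show ?thesis
          using mixed[OF 3 xy(3)[symmetric]] by auto
      next
        case 4
        then show ?thesis
          using IH[OF 4 xy(3)] by auto
      qed simp
    qed
  qed simp
  show ?thesis
    using gen assms(2-4) by blast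
qed

end

section \<open>Averages of sections over the range of heights\<close>

locale stratified_polytope_ends = stratified_polytope P l
  for P :: "'a::euclidean_space set" and l +
  fixes s t :: 'a
  assumes source: "min_vertex l P s"
    and sink: "max_vertex l P t"
    and nontrivial: "aff_dim P \<ge> 1"
begin

definition sections :: "'a set \<Rightarrow> (real \<Rightarrow> 'a) set" where
  "sections U = {\<gamma>. continuous_on {l s..l t} \<gamma> \<and> \<gamma> ` {l s..l t} \<subseteq> U \<and> (\<forall>\<tau>\<in>{l s..l t}. l (\<gamma> \<tau>) = \<tau>)}"

definition average :: "(real \<Rightarrow> 'a) \<Rightarrow> 'a" where
  "average \<gamma> = (1 / (l t - l s)) *\<^sub>R integral {l s..l t} \<gamma>"

abbreviation paths_polytope :: "'a set" where
  "paths_polytope \<equiv> monotone_path_polytope P l"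

lemma source_less_sink: "l s < l t"
  using min_less_max[OF face_of_itself nontrivial source sink] .

lemma height_range: "x \<in> P \<Longrightarrow> l x \<in> {l s..l t}"
  using source sink min_vertex_iff[OF face_of_itself] max_vertex_iff[OF face_of_itself] by auto

lemma paths_polytope_eq: "paths_polytope = average ` sections P"
proof -
  have "s \<in> P" "t \<in> P"
    using source sink min_vertex_iff[OF face_of_itself] max_vertex_iff[OF face_of_itself] by auto
  then have "Inf (l ` P) = l s" "Sup (l ` P) = l t"
    using height_range by (auto intro!: cInf_eq_minimum cSup_eq_maximum)
  then show ?thesis
    by (auto simp: monotone_path_polytope_def sections_def average_def Let_def)
qed

lemma sections_mono: "U \<subseteq> V \<Longrightarrow> sections U \<subseteq> sections V"
  by (auto simp: sections_def)

lemma path_in_sections: "path_in l U s t \<gamma> \<Longrightarrow> \<gamma> \<in> sections U"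
  by (auto simp: path_in_def sections_def)

lemma sections_memD:
  assumes "\<gamma> \<in> sections U" "\<tau> \<in> {l s..l t}"
  shows "\<gamma> \<tau> \<in> U" "l (\<gamma> \<tau>) = \<tau>"
  using assms by (auto simp: sections_def)

lemma linear_average:
  assumes f: "linear f" and \<gamma>: "\<gamma> \<in> sections U"
  shows "f (average \<gamma>) = integral {l s..l t} (\<lambda>\<tau>. f (\<gamma> \<tau>)) / (l t - l s)"
proof -
  have "\<gamma> integrable_on {l s..l t}"
    using \<gamma> integrable_continuous_interval by (auto simp: sections_def)
  then have "integral {l s..l t} (f \<circ> \<gamma>) = f (integral {l s..l t} \<gamma>)"
    using f by (intro integral_linear) (simp_all add: linear_conv_bounded_linear)
  then show ?thesis
    by (simp add: average_def linear_cmul[OF f] comp_def)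
qed

lemma continuous_linear_section:
  fixes f :: "'a \<Rightarrow> real"
  assumes "linear f" "\<gamma> \<in> sections U"
  shows "continuous_on {l s..l t} (\<lambda>\<tau>. f (\<gamma> \<tau>))"
  using assms linear_continuous_on_compose[of "{l s..l t}" \<gamma> f] by (simp add: sections_def)

lemma average_le:
  fixes f :: "'a \<Rightarrow> real"
  assumes f: "linear f" and \<gamma>: "\<gamma> \<in> sections U" and \<delta>: "\<delta> \<in> sections V"
    and le: "\<And>\<tau>. \<tau> \<in> {l s..l t} \<Longrightarrow> f (\<gamma> \<tau>) \<le> f (\<delta> \<tau>)"
  shows "f (average \<gamma>) \<le> f (average \<delta>)"
proof -
  have "integral {l s..l t} (\<lambda>\<tau>. f (\<gamma> \<tau>)) \<le> integral {l s..l t} (\<lambda>\<tau>. f (\<delta> \<tau>))"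
    using continuous_linear_section[OF f \<gamma>] continuous_linear_section[OF f \<delta>] le
    by (intro integral_le integrable_continuous_interval) auto
  then show ?thesis
    unfolding linear_average[OF f \<gamma>] linear_average[OF f \<delta>] using source_less_sink
    by (intro divide_right_mono) auto
qed

text \<open>A nonnegative continuous function with integral zero vanishes.\<close>

lemma average_eq_imp_pointwise:
  fixes f :: "'a \<Rightarrow> real"
  assumes f: "linear f" and \<gamma>: "\<gamma> \<in> sections U" and \<delta>: "\<delta> \<in> sections V"
    and le: "\<And>\<tau>. \<tau> \<in> {l s..l t} \<Longrightarrow> f (\<gamma> \<tau>) \<le> f (\<delta> \<tau>)"
    and eq: "f (average \<gamma>) = f (average \<delta>)" and \<tau>: "\<tau> \<in> {l s..l t}"
  shows "f (\<gamma> \<tau>) = f (\<delta> \<tau>)"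
proof -
  have cont: "continuous_on {l s..l t} (\<lambda>\<tau>. f (\<gamma> \<tau>))" "continuous_on {l s..l t} (\<lambda>\<tau>. f (\<delta> \<tau>))"
    using continuous_linear_section[OF f \<gamma>] continuous_linear_section[OF f \<delta>] .
  have "integral {l s..l t} (\<lambda>\<tau>. f (\<gamma> \<tau>)) = integral {l s..l t} (\<lambda>\<tau>. f (\<delta> \<tau>))"
    using eq source_less_sink unfolding linear_average[OF f \<gamma>] linear_average[OF f \<delta>] by simp
  then have "integral {l s..l t} (\<lambda>\<tau>. f (\<delta> \<tau>) - f (\<gamma> \<tau>)) = 0"
    using cont by (subst integral_diff) (auto intro: integrable_continuous_interval)
  then have "\<forall>\<tau>\<in>{l s..l t}. f (\<delta> \<tau>) - f (\<gamma> \<tau>) = 0"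
    using integral_eq_0_iff[of "l s" "l t" "\<lambda>\<tau>. f (\<delta> \<tau>) - f (\<gamma> \<tau>)"] cont le source_less_sink
    by (simp add: continuous_on_diff)
  with \<tau> show ?thesis
    by fastforce
qed

lemma face_chain_iff_between:
  "face_chain P l Fs \<longleftrightarrow> chain_between P l s Fs t"
proof
  assume "face_chain P l Fs"
  then show "chain_between P l s Fs t"
    using min_vertex_unique[OF face_of_itself source] max_vertex_unique[OF face_of_itself sink]
    unfolding face_chain_iff by metis
next
  assume c: "chain_between P l s Fs t"
  then have "Fs \<noteq> []"
    using source_less_sink by auto
  with c show "face_chain P l Fs"
    using source sink unfolding face_chain_iff by metis
qed

lemma face_chain_nonempty: "face_chain P l Fs \<Longrightarrow> Fs \<noteq> []"
  by (simp add: face_chain_def)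

lemma face_chain_Union_subset: "face_chain P l Fs \<Longrightarrow> \<Union> (set Fs) \<subseteq> P"
  using face_of_imp_subset unfolding face_chain_def by blast

section \<open>Functionals, induced chains and minimizing averages\<close>

lemma induced_chain_exists:
  assumes "linear \<mu>"
  obtains Fs where "induces_chain P l \<mu> Fs"
proof -
  obtain Fs where Fs: "chain_between P l s Fs t"
      "\<And>F. F \<in> set Fs \<Longrightarrow> \<exists>c. min_face (\<lambda>x. \<mu> x - c * l x) P = F"
    using tilted_chain_exists[OF assms source sink] by metis
  then have fc: "face_chain P l Fs"
    by (simp add: face_chain_iff_between)
  then have "induces_chain P l \<mu> Fs"
    unfolding induces_chain_def
    using chain_Union_slices[OF Fs(1) face_chain_nonempty[OF fc] source sink Fs(2)] by blast
  with that show ?thesis .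
qed

lemma induced_chain_unique:
  assumes "induces_chain P l \<mu> Fs" "face_chain P l Gs" "\<Union> (set Fs) = \<Union> (set Gs)"
  shows "Fs = Gs"
proof (rule chain_unique[OF _ _ assms(3)])
  show "chain_between P l s Fs t" "chain_between P l s Gs t"
    using assms(1,2) by (simp_all add: induces_chain_def face_chain_iff_between)
qed

text \<open>\<open>chain_coherent\<close> works inside \<open>F_minus\<close> of the last vertex; at
  the sink it yields a functional for all of \<open>P\<close>.\<close>

lemma F_minus_sink: "F_minus P l t = P"
proof
  have t: "t \<in> P" "\<And>x. x \<in> P \<Longrightarrow> l x \<le> l t" "t extreme_point_of P"
    using sink max_vertex_iff[OF face_of_itself] by (auto simp: max_vertex_def)
  show "P \<subseteq> F_minus P l t"
    using face_subset_F_minus[OF face_of_itself] t by blast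
  show "F_minus P l t \<subseteq> P"
    using F_minus_face[OF t(3)] face_of_imp_subset by blast
qed

lemma face_chain_induced:
  assumes "face_chain P l Fs"
  obtains \<mu> where "linear \<mu>" "induces_chain P l \<mu> Fs"
proof -
  have chain: "chain_between P l s Fs t"
    using assms by (simp add: face_chain_iff_between)
  moreover have "s extreme_point_of P"
    using source by (simp add: min_vertex_def)
  ultimately have "\<exists>\<mu>. linear \<mu> \<and> (\<forall>F\<in>set Fs. \<exists>c. min_face (\<lambda>x. \<mu> x - c * l x) P = F)"
    using chain_coherent[of s Fs t] unfolding F_minus_sink by blast
  then obtain \<mu> where mu: "linear \<mu>"
      "\<And>F. F \<in> set Fs \<Longrightarrow> \<exists>c. min_face (\<lambda>x. \<mu> x - c * l x) P = F"
    by blast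
  then have "induces_chain P l \<mu> Fs"
    unfolding induces_chain_def
    using assms chain_Union_slices[OF chain face_chain_nonempty[OF assms] source sink mu(2)] by blast
  with mu(1) show ?thesis
    by (rule that)
qed

lemma chain_section_exists:
  assumes "face_chain P l Fs"
  shows "sections (\<Union> (set Fs)) \<noteq> {}"
proof -
  have chain: "chain_between P l s Fs t"
    using assms by (simp add: face_chain_iff_between)
  obtain \<gamma> where "path_in l (insert s (\<Union> (set Fs))) s t \<gamma>"
    using chain_path_exists[OF chain] by blast
  moreover have "insert s (\<Union> (set Fs)) = \<Union> (set Fs)"
    using chain_start_in_Union[OF chain face_chain_nonempty[OF assms]] by blast
  ultimately have "\<gamma> \<in> sections (\<Union> (set Fs))"
    using path_in_sections by simp
  then show ?thesis by blast
qed

lemma induced_Union_iff: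
  assumes "induces_chain P l \<mu> Fs"
  shows "x \<in> \<Union> (set Fs) \<longleftrightarrow> x \<in> P \<and> (\<forall>y\<in>P. l y = l x \<longrightarrow> \<mu> x \<le> \<mu> y)"
proof -
  have "\<Union> (set Fs) = (\<Union>c. min_face \<mu> (P \<inter> {x. l x = c}))"
    using assms by (simp add: induces_chain_def)
  then show ?thesis
    by (auto simp: min_face_def)
qed

text \<open>A section inside the union minimizes \<open>\<mu>\<close> at every height. A section
  with minimal average has the same values of \<open>\<mu>\<close>, by
  \<open>average_eq_imp_pointwise\<close>, so it minimizes on every slice too.\<close>

lemma section_in_min_face:
  assumes mu: "linear \<mu>" and ind: "induces_chain P l \<mu> Fs"
    and \<delta>: "\<delta> \<in> sections P" and min: "average \<delta> \<in> min_face \<mu> paths_polytope"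
  shows "\<delta> \<in> sections (\<Union> (set Fs))"
proof -
  have fc: "face_chain P l Fs"
    using ind by (simp add: induces_chain_def)
  obtain \<gamma> where \<gamma>: "\<gamma> \<in> sections (\<Union> (set Fs))"
    using chain_section_exists[OF fc] by blast
  then have \<gamma>P: "\<gamma> \<in> sections P"
    using sections_mono[OF face_chain_Union_subset[OF fc]] by blast
  have le: "\<mu> (\<gamma> \<tau>) \<le> \<mu> (\<delta> \<tau>)" if "\<tau> \<in> {l s..l t}" for \<tau>
    using induced_Union_iff[OF ind, of "\<gamma> \<tau>"] sections_memD[OF \<gamma> that] sections_memD[OF \<delta> that] by auto
  have "average \<gamma> \<in> paths_polytope"
    using \<gamma>P paths_polytope_eq by blast
  then have "\<mu> (average \<delta>) \<le> \<mu> (average \<gamma>)"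
    using min by (simp add: min_face_def)
  then have eq: "\<mu> (average \<gamma>) = \<mu> (average \<delta>)"
    using average_le[OF mu \<gamma> \<delta> le] by simp
  have "\<delta> \<tau> \<in> \<Union> (set Fs)" if \<tau>: "\<tau> \<in> {l s..l t}" for \<tau>
  proof -
    have "\<mu> (\<gamma> \<tau>) = \<mu> (\<delta> \<tau>)"
      using average_eq_imp_pointwise[OF mu \<gamma> \<delta> le eq \<tau>] .
    moreover have "\<forall>y\<in>P. l y = l (\<gamma> \<tau>) \<longrightarrow> \<mu> (\<gamma> \<tau>) \<le> \<mu> y"
      using induced_Union_iff[OF ind] sections_memD(1)[OF \<gamma> \<tau>] by blast
    ultimately show ?thesis
      using induced_Union_iff[OF ind, of "\<delta> \<tau>"] sections_memD[OF \<gamma> \<tau>] sections_memD[OF \<delta> \<tau>] by auto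
  qed
  then show ?thesis
    using \<delta> by (auto simp: sections_def)
qed

lemma min_face_paths_polytope:
  assumes mu: "linear \<mu>" and ind: "induces_chain P l \<mu> Fs"
  shows "min_face \<mu> paths_polytope = average ` sections (\<Union> (set Fs))"
proof
  have fc: "face_chain P l Fs"
    using ind by (simp add: induces_chain_def)
  show "min_face \<mu> paths_polytope \<subseteq> average ` sections (\<Union> (set Fs))"
  proof
    fix m assume m: "m \<in> min_face \<mu> paths_polytope"
    then obtain \<delta> where "\<delta> \<in> sections P" "m = average \<delta>"
      using min_face_subset paths_polytope_eq by blast
    with m show "m \<in> average ` sections (\<Union> (set Fs))"
      using section_in_min_face[OF mu ind] by blast
  qed
  show "average ` sections (\<Union> (set Fs)) \<subseteq> min_face \<mu> paths_polytope"
  proof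
    fix m assume "m \<in> average ` sections (\<Union> (set Fs))"
    then obtain \<gamma> where \<gamma>: "\<gamma> \<in> sections (\<Union> (set Fs))" "m = average \<gamma>"
      by blast
    have "average \<gamma> \<in> paths_polytope"
      unfolding paths_polytope_eq using \<gamma>(1) sections_mono[OF face_chain_Union_subset[OF fc]] by blast
    moreover have "\<mu> (average \<gamma>) \<le> \<mu> (average \<delta>)" if \<delta>: "\<delta> \<in> sections P" for \<delta>
    proof (rule average_le[OF mu \<gamma>(1) \<delta>])
      show "\<mu> (\<gamma> \<tau>) \<le> \<mu> (\<delta> \<tau>)" if "\<tau> \<in> {l s..l t}" for \<tau>
        using induced_Union_iff[OF ind, of "\<gamma> \<tau>"] sections_memD[OF \<gamma>(1) that] sections_memD[OF \<delta> that] by auto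
    qed
    ultimately show "m \<in> min_face \<mu> paths_polytope"
      using \<gamma>(2) paths_polytope_eq by (auto simp: min_face_def)
  qed
qed

lemma chain_section_through:
  assumes "face_chain P l Fs" "x \<in> \<Union> (set Fs)"
  obtains \<gamma> where "\<gamma> \<in> sections (\<Union> (set Fs))" "\<gamma> (l x) = x"
proof -
  have chain: "chain_between P l s Fs t"
    using assms(1) by (simp add: face_chain_iff_between)
  obtain F where "F \<in> set Fs" "x \<in> F"
    using assms(2) by blast
  then obtain \<gamma> where "path_in l (\<Union> (set Fs)) s t \<gamma>" "\<gamma> (l x) = x"
    using chain_two_paths[OF chain _ _ _ refl] by blast
  then show ?thesis
    using that path_in_sections by blast
qed

text \<open>The induced chain depends only on the face: a section through any point \<open>x\<close>
  of the first union has its average in the second face, hence runs inside the second union, and at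
  height \<open>l x\<close> it is at \<open>x\<close>.\<close>

lemma induced_subset_of_min_face_subset:
  assumes "linear \<mu>" "induces_chain P l \<mu> Fs" "linear \<nu>" "induces_chain P l \<nu> Gs"
    and sub: "min_face \<mu> paths_polytope \<subseteq> min_face \<nu> paths_polytope"
  shows "\<Union> (set Fs) \<subseteq> \<Union> (set Gs)"
proof
  have fc: "face_chain P l Fs"
    using assms(2) by (simp add: induces_chain_def)
  fix x assume x: "x \<in> \<Union> (set Fs)"
  obtain \<gamma> where \<gamma>: "\<gamma> \<in> sections (\<Union> (set Fs))" "\<gamma> (l x) = x"
    using chain_section_through[OF fc x] by blast
  have "average \<gamma> \<in> min_face \<nu> paths_polytope"
    using sub \<gamma>(1) unfolding min_face_paths_polytope[OF assms(1,2)] by blast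
  moreover have "\<gamma> \<in> sections P"
    using \<gamma>(1) sections_mono[OF face_chain_Union_subset[OF fc]] by blast
  ultimately have "\<gamma> \<in> sections (\<Union> (set Gs))"
    using section_in_min_face[OF assms(3,4)] by blast
  moreover have "l x \<in> {l s..l t}"
    using x face_chain_Union_subset[OF fc] height_range by blast
  ultimately show "x \<in> \<Union> (set Gs)"
    using sections_memD(1) \<gamma>(2) by metis
qed

lemma induced_chain_eq_of_min_face_eq:
  assumes "linear \<mu>" "induces_chain P l \<mu> Fs" "linear \<nu>" "induces_chain P l \<nu> Gs"
    and "min_face \<mu> paths_polytope = min_face \<nu> paths_polytope"
  shows "Fs = Gs"
proof (rule induced_chain_unique[OF assms(2)])
  show "face_chain P l Gs"
    using assms(4) by (simp add: induces_chain_def)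
  show "\<Union> (set Fs) = \<Union> (set Gs)"
    using induced_subset_of_min_face_subset[OF assms(1-4)]
      induced_subset_of_min_face_subset[OF assms(3,4,1,2)] assms(5) by blast
qed

section \<open>The averages form a polytope\<close>

lemma convex_paths_polytope: "convex paths_polytope"
proof (rule convexI)
  fix m m' and u v :: real
  assume "m \<in> paths_polytope" "m' \<in> paths_polytope" and uv: "0 \<le> u" "0 \<le> v" "u + v = 1"
  then obtain \<gamma> \<delta> where \<gamma>: "\<gamma> \<in> sections P" "m = average \<gamma>" and \<delta>: "\<delta> \<in> sections P" "m' = average \<delta>"
    unfolding paths_polytope_eq by blast
  let ?\<rho> = "\<lambda>\<tau>. u *\<^sub>R \<gamma> \<tau> + v *\<^sub>R \<delta> \<tau>"
  have cont: "continuous_on {l s..l t} \<gamma>" "continuous_on {l s..l t} \<delta>"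
    using \<gamma> \<delta> by (auto simp: sections_def)
  have "?\<rho> \<tau> \<in> P" "l (?\<rho> \<tau>) = \<tau>" if \<tau>: "\<tau> \<in> {l s..l t}" for \<tau>
  proof -
    show "?\<rho> \<tau> \<in> P"
      using convexD[OF polytope_imp_convex[OF polytope]] uv
        sections_memD(1)[OF \<gamma>(1) \<tau>] sections_memD(1)[OF \<delta>(1) \<tau>] by blast
    have "l (?\<rho> \<tau>) = u * \<tau> + v * \<tau>"
      using sections_memD(2)[OF \<gamma>(1) \<tau>] sections_memD(2)[OF \<delta>(1) \<tau>]
      by (simp add: linear_add[OF linear] linear_cmul[OF linear])
    then show "l (?\<rho> \<tau>) = \<tau>"
      using uv(3) by (simp add: distrib_right[symmetric])
  qed
  moreover have "continuous_on {l s..l t} ?\<rho>"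
    using cont by (intro continuous_intros)
  ultimately have "?\<rho> \<in> sections P"
    by (auto simp: sections_def)
  moreover have "average ?\<rho> = u *\<^sub>R m + v *\<^sub>R m'"
  proof -
    have "\<gamma> integrable_on {l s..l t}" "\<delta> integrable_on {l s..l t}"
      using cont integrable_continuous_interval by auto
    then have "integral {l s..l t} ?\<rho> = u *\<^sub>R integral {l s..l t} \<gamma> + v *\<^sub>R integral {l s..l t} \<delta>"
      by (simp add: integral_add integrable_cmul)
    then show ?thesis
      by (simp add: \<gamma>(2) \<delta>(2) average_def scaleR_add_right mult.commute)
  qed
  ultimately show "u *\<^sub>R m + v *\<^sub>R m' \<in> paths_polytope"
    unfolding paths_polytope_eq by force
qed

text \<open>Every functional is minimized at the average of a section in a union of faces, and one section
  for each of the finitely many such unions suffices.\<close>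

lemma polytope_paths_polytope: "polytope paths_polytope"
proof -
  \<comment> \<open>Arbitrary sets of faces replace chains here, because their number is visibly
    finite and a chain matters only through its union.\<close>
  define \<A> where "\<A> = {A. A \<subseteq> {F. F face_of P} \<and> sections (\<Union> A) \<noteq> {}}"
  define sec where "sec = (\<lambda>A. SOME \<gamma>. \<gamma> \<in> sections (\<Union> A))"
  define S where "S = (\<lambda>A. average (sec A)) ` \<A>"
  have sec: "sec A \<in> sections (\<Union> A)" if "A \<in> \<A>" for A
    using that unfolding sec_def \<A>_def by (simp add: some_in_eq)
  have "finite (Pow {F. F face_of P})"
    using finite_polytope_faces[OF polytope] by simp
  then have "finite \<A>"
    by (rule rev_finite_subset) (auto simp: \<A>_def)
  then have fin: "finite S"
    by (simp add: S_def)
  have "sec A \<in> sections P" if "A \<in> \<A>" for A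
  proof -
    have "\<Union> A \<subseteq> P"
      using that face_of_imp_subset by (auto simp: \<A>_def)
    then show ?thesis
      using sec[OF that] sections_mono by blast
  qed
  then have "S \<subseteq> paths_polytope"
    unfolding S_def paths_polytope_eq by blast
  then have sub: "convex hull S \<subseteq> paths_polytope"
    using convex_paths_polytope by (rule hull_minimal)
  have "paths_polytope \<subseteq> convex hull S"
  proof (rule ccontr)
    assume "\<not> paths_polytope \<subseteq> convex hull S"
    then obtain m where m: "m \<in> paths_polytope" "m \<notin> convex hull S"
      by blast
    have "closed (convex hull S)"
      using fin finite_imp_compact_convex_hull compact_imp_closed by blast
    then obtain a b where ab: "a \<bullet> m < b" "\<forall>x\<in>convex hull S. b < a \<bullet> x"
      using separating_hyperplane_closed_point[OF convex_convex_hull _ m(2)] by blast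
    have lin: "linear (\<lambda>x. a \<bullet> x)"
      by (simp add: bounded_linear.linear bounded_linear_inner_right)
    obtain Fs where Fs: "induces_chain P l (\<lambda>x. a \<bullet> x) Fs"
      using induced_chain_exists[OF lin] by blast
    then have fc: "face_chain P l Fs"
      by (simp add: induces_chain_def)
    then have A: "set Fs \<in> \<A>"
      using chain_section_exists[OF fc] unfolding \<A>_def face_chain_def by blast
    then have "average (sec (set Fs)) \<in> min_face (\<lambda>x. a \<bullet> x) paths_polytope"
      using sec min_face_paths_polytope[OF lin Fs] by blast
    then have "a \<bullet> average (sec (set Fs)) \<le> a \<bullet> m"
      using m(1) by (simp add: min_face_def)
    moreover have "average (sec (set Fs)) \<in> convex hull S"
      using A unfolding S_def by (intro hull_inc) blast
    ultimately show False
      using ab by force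
  qed
  with sub have "paths_polytope = convex hull S"
    by blast
  with fin show ?thesis
    unfolding polytope_def by blast
qed

text \<open>Faces of a polytope are exposed, so every nonempty face is reached by some
  functional.\<close>

lemma face_of_paths_polytope_min_face:
  assumes "\<Phi> face_of paths_polytope" "\<Phi> \<noteq> {}"
  obtains \<mu> :: "'a \<Rightarrow> real" where "linear \<mu>" "min_face \<mu> paths_polytope = \<Phi>"
proof -
  obtain f :: "'a \<Rightarrow> real" and c where f: "linear f" "\<And>x. x \<in> paths_polytope \<Longrightarrow> c \<le> f x"
      "\<Phi> = {x \<in> paths_polytope. f x = c}"
    using polytope_face_exposed[OF polytope_paths_polytope assms(1)] by metis
  obtain z where z: "z \<in> paths_polytope" "f z = c"
    using assms(2) f(3) by blast
  have "min_face f paths_polytope = {x \<in> paths_polytope. f x = f z}"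
    using z f(2) by (intro min_face_at) auto
  then show ?thesis
    using that[OF f(1)] f(3) z(2) by simp
qed

lemma min_face_paths_polytope_face:
  assumes "linear \<mu>"
  shows "min_face \<mu> paths_polytope face_of paths_polytope" "min_face \<mu> paths_polytope \<noteq> {}"
proof -
  show "min_face \<mu> paths_polytope face_of paths_polytope"
    using min_face_face_of[OF convex_paths_polytope assms] .
  obtain Fs where Fs: "induces_chain P l \<mu> Fs"
    using induced_chain_exists[OF assms] by blast
  then show "min_face \<mu> paths_polytope \<noteq> {}"
    using min_face_paths_polytope[OF assms Fs] chain_section_exists by (simp add: induces_chain_def)
qed

end

section \<open>Dimension of the faces\<close>

context stratified_polytope
begin

text \<open>Induction from the end: all faces before \<open>F\<close> lie in
  \<open>F_minus P l v\<close> for the minimal vertex \<open>v\<close> of \<open>F\<close>, so their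
  directions meet those of \<open>F\<close> only in 0 and the dimensions add.\<close>

lemma chain_dim:
  assumes "chain_between P l u Fs w" "u extreme_point_of P"
  shows "int (dim (span (\<Union>F\<in>set Fs. directions F \<inter> {x. l x = 0})))
    = (\<Sum>F\<leftarrow>Fs. aff_dim F) - int (length Fs)"
  using assms
proof (induction Fs arbitrary: w rule: rev_induct)
  case (snoc F Fs)
  then obtain v where v: "chain_between P l u Fs v" "F face_of P" "aff_dim F \<ge> 1"
      "min_vertex l F v" "max_vertex l F w"
    by (auto simp: chain_between_snoc)
  let ?A = "\<Union>G\<in>set Fs. directions G \<inter> {x. l x = 0}"
  let ?B = "directions F \<inter> {x. l x = 0}"
  have B: "subspace ?B"
    using subspace_kernel_Int[OF subspace_directions linear] .
  have vw: "v \<in> F" "w \<in> F"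
    using v(4,5) min_vertex_iff[OF v(2)] max_vertex_iff[OF v(2)] by auto
  have "directions G \<inter> {x. l x = 0} \<subseteq> directions (F_minus P l v)" if "G \<in> set Fs" for G
    using directions_mono[OF chain_subset_F_minus[OF v(1) snoc.prems(2) that]] by blast
  then have "span ?A \<subseteq> directions (F_minus P l v)"
    by (intro span_minimal subspace_directions) blast
  then have "span ?A \<inter> ?B \<subseteq> {0}"
    using directions_Int_F_minus[OF v(2,4)] by blast
  then have dim0: "dim (span ?A \<inter> ?B) = 0"
    by (simp only: dim_eq_0)
  have span_eq: "span (\<Union>G\<in>set (Fs @ [F]). directions G \<inter> {x. l x = 0})
      = {x + y | x y. x \<in> span ?A \<and> y \<in> ?B}"
  proof -
    have "(\<Union>G\<in>set (Fs @ [F]). directions G \<inter> {x. l x = 0}) = ?A \<union> ?B"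
      by auto
    moreover have "span ?B = ?B"
      using B by (simp only: span_eq_iff)
    ultimately show ?thesis
      by (simp only: span_Un)
  qed
  have "dim (span (\<Union>G\<in>set (Fs @ [F]). directions G \<inter> {x. l x = 0}))
      = dim (span ?A) + dim ?B"
    unfolding span_eq using dim_sums_Int[OF subspace_span B, of ?A]
    unfolding dim0 by (simp only: add_0_right)
  moreover have "int (dim ?B) = aff_dim F - 1"
  proof -
    have "w - v \<in> directions F" "l (w - v) \<noteq> 0"
      using vw min_less_max[OF v(2-5)] by (auto simp: diff_in_directions linear_diff[OF linear])
    then have "dim ?B + 1 = dim (directions F)"
      using dim_Int_kernel[OF subspace_directions linear] by blast
    moreover have "aff_dim F = int (dim (directions F))"
      using aff_dim_directions vw by blast
    ultimately show ?thesis
      by linarith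
  qed
  ultimately show ?case
    using snoc.IH[OF v(1) snoc.prems(2)] by simp
qed simp

end

context stratified_polytope_ends
begin

text \<open>If \<open>f\<close> separates two points of equal height in a face, the two paths of
  \<open>chain_two_paths\<close> have different averages under \<open>f\<close>. Conversely, two
  sections at the same height lie in a common face, and their difference is a direction with
  \<open>l = 0\<close>.\<close>

lemma averages_const_iff:
  fixes f :: "'a \<Rightarrow> real"
  assumes fc: "face_chain P l Fs" and f: "linear f"
  shows "(\<forall>\<gamma>\<in>sections (\<Union> (set Fs)). \<forall>\<delta>\<in>sections (\<Union> (set Fs)). f (average \<gamma>) = f (average \<delta>)) \<longleftrightarrow>
    (\<forall>F\<in>set Fs. \<forall>x\<in>directions F \<inter> {x. l x = 0}. f x = 0)"
    (is "?const \<longleftrightarrow> ?zero")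
proof
  let ?U = "\<Union> (set Fs)"
  have chain: "chain_between P l s Fs t"
    using fc by (simp add: face_chain_iff_between)
  show ?zero if const: ?const
  proof (intro ballI)
    fix F d assume F: "F \<in> set Fs" and d: "d \<in> directions F \<inter> {x. l x = 0}"
    have FP: "F face_of P" "aff_dim F \<ge> 1"
      using chain_between_face[OF chain F] by auto
    have le: "f y \<le> f x" if xy: "x \<in> F" "y \<in> F" "l y = l x" for x y
    proof (rule ccontr)
      assume less: "\<not> f y \<le> f x"
      obtain \<gamma> \<delta> where p: "path_in l ?U s t \<gamma>" "path_in l ?U s t \<delta>" "\<gamma> (l x) = x" "\<delta> (l x) = y"
          "\<And>(f :: 'a \<Rightarrow> real) \<tau>. linear f \<and> f x \<le> f y \<and> l s \<le> \<tau> \<and> \<tau> \<le> l t \<Longrightarrow> f (\<gamma> \<tau>) \<le> f (\<delta> \<tau>)"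
        using chain_two_paths[OF chain F xy] by blast
      have sec: "\<gamma> \<in> sections ?U" "\<delta> \<in> sections ?U"
        using p(1,2) path_in_sections by blast+
      have "f (average \<gamma>) = f (average \<delta>)"
        using const sec by blast
      moreover have "f (\<gamma> \<tau>) \<le> f (\<delta> \<tau>)" if "\<tau> \<in> {l s..l t}" for \<tau>
        using p(5)[of f \<tau>] f less that by simp
      moreover have "l x \<in> {l s..l t}"
        using height_range xy(1) FP(1) face_of_imp_subset by blast
      ultimately have "f (\<gamma> (l x)) = f (\<delta> (l x))"
        using average_eq_imp_pointwise[OF f sec] by blast
      with p(3,4) less show False
        by simp
    qed
    have conv: "convex F"
      using FP(1) face_of_imp_convex by blast
    have "F \<noteq> {}"
      using FP(2) by auto
    then obtain z where z: "z \<in> rel_interior F"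
      using rel_interior_eq_empty[OF conv] by blast
    then obtain e where e: "e > 0" "cball z e \<inter> affine hull F \<subseteq> F" and zF: "z \<in> F"
      by (auto simp: mem_rel_interior_cball)
    define c where "c = e / (norm d + 1)"
    have np: "0 < norm d + 1"
      using norm_ge_zero[of d] by linarith
    have c: "c > 0" "c * norm d \<le> e"
    proof -
      show "c > 0"
        using e(1) np by (simp add: c_def)
      have "c * norm d \<le> c * (norm d + 1)"
        using \<open>c > 0\<close> by (intro mult_left_mono) auto
      also have "\<dots> = e"
        using np by (simp add: c_def)
      finally show "c * norm d \<le> e" .
    qed
    have cd: "c *\<^sub>R d \<in> directions F"
      using d subspace_directions subspace_mul by blast
    have "z + c *\<^sub>R d \<in> cball z e"
      using c by (simp add: dist_norm)
    then have w: "z + c *\<^sub>R d \<in> F"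
      using e(2) add_directions_in_affine_hull[OF zF cd] by blast
    have lw: "l (z + c *\<^sub>R d) = l z"
      using d by (simp add: linear_add[OF linear] linear_cmul[OF linear])
    have "f (z + c *\<^sub>R d) = f z"
      using le[OF zF w lw] le[OF w zF lw[symmetric]] by simp
    then show "f d = 0"
      using c(1) by (simp add: linear_add[OF f] linear_cmul[OF f])
  qed
  show ?const if zero: ?zero
  proof (intro ballI)
    fix \<gamma> \<delta> assume sec: "\<gamma> \<in> sections ?U" "\<delta> \<in> sections ?U"
    have eq: "f (\<gamma> \<tau>) = f (\<delta> \<tau>)" if \<tau>: "\<tau> \<in> {l s..l t}" for \<tau>
    proof -
      have l_eq: "l (\<gamma> \<tau>) = l (\<delta> \<tau>)"
        using sections_memD(2)[OF sec(1) \<tau>] sections_memD(2)[OF sec(2) \<tau>] by simp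
      then obtain F where F: "F \<in> set Fs" "\<gamma> \<tau> \<in> F" "\<delta> \<tau> \<in> F"
        using chain_slice_in_face[OF chain sections_memD(1)[OF sec(1) \<tau>] sections_memD(1)[OF sec(2) \<tau>]]
        by blast
      then have "\<gamma> \<tau> - \<delta> \<tau> \<in> directions F \<inter> {x. l x = 0}"
        using l_eq by (simp add: diff_in_directions linear_diff[OF linear])
      then have "f (\<gamma> \<tau> - \<delta> \<tau>) = 0"
        using zero F(1) by blast
      then show ?thesis
        by (simp add: linear_diff[OF f])
    qed
    show "f (average \<gamma>) = f (average \<delta>)"
      using average_le[OF f sec] average_le[OF f sec(2,1)] eq by (simp add: order.antisym)
  qed
qed

lemma directions_averages:
  assumes "face_chain P l Fs"
  shows "directions (average ` sections (\<Union> (set Fs)))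
    = span (\<Union>F\<in>set Fs. directions F \<inter> {x. l x = 0})"
proof (rule subspace_eq_of_annihilators)
  fix f :: "'a \<Rightarrow> real" assume f: "linear f"
  have span_zero: "(\<forall>x\<in>span X. f x = 0) \<longleftrightarrow> (\<forall>x\<in>X. f x = 0)" for X
  proof
    show "\<forall>x\<in>span X. f x = 0" if "\<forall>x\<in>X. f x = 0"
      using span_minimal[of X "{x. f x = 0}"] linear_subspace_kernel[OF f] that by blast
  qed (use span_base in blast)
  have "(\<forall>x\<in>directions (average ` sections (\<Union> (set Fs))). f x = 0) \<longleftrightarrow>
      (\<forall>\<gamma>\<in>sections (\<Union> (set Fs)). \<forall>\<delta>\<in>sections (\<Union> (set Fs)). f (average \<gamma> - average \<delta>) = 0)"
    unfolding directions_def span_zero by blast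
  also have "\<dots> \<longleftrightarrow> (\<forall>x\<in>span (\<Union>F\<in>set Fs. directions F \<inter> {x. l x = 0}). f x = 0)"
    using averages_const_iff[OF assms f] unfolding span_zero linear_diff[OF f] right_minus_eq by blast
  finally show "(\<forall>x\<in>directions (average ` sections (\<Union> (set Fs))). f x = 0) \<longleftrightarrow>
      (\<forall>x\<in>span (\<Union>F\<in>set Fs. directions F \<inter> {x. l x = 0}). f x = 0)" .
qed (simp_all add: subspace_directions)

lemma aff_dim_averages:
  assumes "face_chain P l Fs"
  shows "aff_dim (average ` sections (\<Union> (set Fs))) = (\<Sum>F\<leftarrow>Fs. aff_dim F) - int (length Fs)"
proof -
  have "average ` sections (\<Union> (set Fs)) \<noteq> {}"
    using chain_section_exists[OF assms] by simp
  moreover have "chain_between P l s Fs t" "s extreme_point_of P"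
    using assms source by (simp_all add: face_chain_iff_between min_vertex_def)
  ultimately show ?thesis
    using aff_dim_directions directions_averages[OF assms] chain_dim by metis
qed

section \<open>The bijection between faces and chains\<close>

text \<open>The description by \<open>THE\<close> is legitimate, because functionals with the same
  minimizing face induce the same chain.\<close>

lemma corresponding_chain_min_face:
  assumes "linear \<mu>" "induces_chain P l \<mu> Fs"
  shows "corresponding_chain P l (min_face \<mu> paths_polytope) = Fs"
  unfolding corresponding_chain_def
proof (rule the_equality)
  show "\<exists>\<nu>. linear \<nu> \<and> min_face \<nu> paths_polytope = min_face \<mu> paths_polytope \<and> induces_chain P l \<nu> Fs"
    using assms by blast
  show "Gs = Fs"
    if "\<exists>\<nu>. linear \<nu> \<and> min_face \<nu> paths_polytope = min_face \<mu> paths_polytope \<and> induces_chain P l \<nu> Gs" for Gs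
    using that induced_chain_eq_of_min_face_eq[OF _ _ assms] by blast
qed

lemma induces_chain_iff_corresponding:
  assumes "linear \<mu>"
  shows "induces_chain P l \<mu> Fs \<longleftrightarrow> Fs = corresponding_chain P l (min_face \<mu> paths_polytope)"
proof -
  obtain Gs where "induces_chain P l \<mu> Gs"
    using induced_chain_exists[OF assms] by blast
  then show ?thesis
    using corresponding_chain_min_face[OF assms] by blast
qed

lemma paths_polytope_face:
  assumes "\<Phi> face_of paths_polytope" "\<Phi> \<noteq> {}"
  shows "face_chain P l (corresponding_chain P l \<Phi>)"
    and "\<Phi> = average ` sections (\<Union> (set (corresponding_chain P l \<Phi>)))"
proof -
  obtain \<mu> :: "'a \<Rightarrow> real" where mu: "linear \<mu>" "min_face \<mu> paths_polytope = \<Phi>"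
    using face_of_paths_polytope_min_face[OF assms] by blast
  then have ind: "induces_chain P l \<mu> (corresponding_chain P l \<Phi>)"
    using induces_chain_iff_corresponding[OF mu(1)] by simp
  then show "face_chain P l (corresponding_chain P l \<Phi>)"
    by (simp add: induces_chain_def)
  show "\<Phi> = average ` sections (\<Union> (set (corresponding_chain P l \<Phi>)))"
    using min_face_paths_polytope[OF mu(1) ind] mu(2) by simp
qed

text \<open>A face is recovered from its chain as the set of averages of sections in the union,
  which gives injectivity. Surjectivity is the coherence of chains.\<close>

lemma bij_betw_corresponding_chain:
  "bij_betw (corresponding_chain P l) {\<Phi>. \<Phi> face_of paths_polytope \<and> \<Phi> \<noteq> {}} {Fs. face_chain P l Fs}"
proof (rule bij_betw_imageI)
  show "inj_on (corresponding_chain P l) {\<Phi>. \<Phi> face_of paths_polytope \<and> \<Phi> \<noteq> {}}"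
  proof (rule inj_onI)
    fix \<Phi> \<Psi>
    assume "\<Phi> \<in> {\<Phi>. \<Phi> face_of paths_polytope \<and> \<Phi> \<noteq> {}}" "\<Psi> \<in> {\<Phi>. \<Phi> face_of paths_polytope \<and> \<Phi> \<noteq> {}}"
      and "corresponding_chain P l \<Phi> = corresponding_chain P l \<Psi>"
    then show "\<Phi> = \<Psi>"
      using paths_polytope_face(2)[of \<Phi>] paths_polytope_face(2)[of \<Psi>] by simp
  qed
  have "Fs \<in> corresponding_chain P l ` {\<Phi>. \<Phi> face_of paths_polytope \<and> \<Phi> \<noteq> {}}" if fc: "face_chain P l Fs" for Fs
  proof -
    obtain \<mu> where mu: "linear \<mu>" "induces_chain P l \<mu> Fs"
      using face_chain_induced[OF fc] by blast
    show ?thesis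
    proof (rule image_eqI)
      show "Fs = corresponding_chain P l (min_face \<mu> paths_polytope)"
        using corresponding_chain_min_face[OF mu] by simp
      show "min_face \<mu> paths_polytope \<in> {\<Phi>. \<Phi> face_of paths_polytope \<and> \<Phi> \<noteq> {}}"
        using min_face_paths_polytope_face[OF mu(1)] by simp
    qed
  qed
  then show "corresponding_chain P l ` {\<Phi>. \<Phi> face_of paths_polytope \<and> \<Phi> \<noteq> {}} = {Fs. face_chain P l Fs}"
    using paths_polytope_face(1) by auto
qed

end


theorem theorem3p10:
  fixes P :: "(real ^ 'n) set" and l :: "real ^ 'n \<Rightarrow> real"
  assumes "polytope P"
    and "aff_dim P \<ge> 1"
    and "linear l"
    and "\<And>e. e edge_of P \<Longrightarrow> \<not> l constant_on e"
    and "\<And>v. v extreme_point_of P \<Longrightarrow> F_minus P l v face_of P \<and> F_plus P l v face_of P"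
    and "O_minus_stratification P l"
  shows "(\<forall>\<mu> Fs. linear \<mu> \<longrightarrow>
            (induces_chain P l \<mu> Fs \<longleftrightarrow>
             Fs = corresponding_chain P l (min_face \<mu> (monotone_path_polytope P l))))
       \<and> bij_betw (corresponding_chain P l)
           {\<Phi>. \<Phi> face_of monotone_path_polytope P l \<and> \<Phi> \<noteq> {}}
           {Fs. face_chain P l Fs}
       \<and> (\<forall>\<Phi>. \<Phi> face_of monotone_path_polytope P l \<and> \<Phi> \<noteq> {} \<longrightarrow>
            aff_dim \<Phi> = (\<Sum>F\<leftarrow>corresponding_chain P l \<Phi>. aff_dim F)
                        - int (length (corresponding_chain P l \<Phi>)))"
proof -
  interpret stratified_polytope P l
    using assms
    by (intro stratified_polytope.intro generic_polytope.intro stratified_polytope_axioms.intro) auto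
  have "P \<noteq> {}"
    using assms(2) by auto
  then obtain s t where "min_vertex l P s" "max_vertex l P t"
    using min_vertex_exists[OF face_of_itself] max_vertex_exists[OF face_of_itself] by metis
  then interpret stratified_polytope_ends P l s t
    using assms(2) by unfold_locales
  show ?thesis
  proof (intro conjI allI impI)
    show "induces_chain P l \<mu> Fs \<longleftrightarrow> Fs = corresponding_chain P l (min_face \<mu> (monotone_path_polytope P l))"
      if "linear \<mu>" for \<mu> Fs
      using induces_chain_iff_corresponding[OF that] .
    show "bij_betw (corresponding_chain P l) {\<Phi>. \<Phi> face_of monotone_path_polytope P l \<and> \<Phi> \<noteq> {}}
        {Fs. face_chain P l Fs}"
      by (rule bij_betw_corresponding_chain)
    show "aff_dim \<Phi> = (\<Sum>F\<leftarrow>corresponding_chain P l \<Phi>. aff_dim F) - int (length (corresponding_chain P l \<Phi>))"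
      if "\<Phi> face_of monotone_path_polytope P l \<and> \<Phi> \<noteq> {}" for \<Phi>
      using that paths_polytope_face[of \<Phi>] aff_dim_averages by metis
  qed
qed

end
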